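(* Let $(X_k)_{k\ge 0}$ be a sequence of independent real-valued random variables on a probability space $(\Omega,\mathcal A,\mathbb P)$ satisfying one of the following: (polynomial case) there exist $\beta>0$ and $d>0$ with $\mathbb E|X_k|^\beta=\mathcal O(k^d)$; or (subexponential case) there exist $\beta>0$ and $\gamma\in(0,1)$ with $\mathbb E|X_k|^\beta=\mathcal O(2^{k^\gamma})$. Define, for $n\ge 1$, $$c_n=\begin{cases}1+\sqrt{\log n} & \text{in the polynomial case},\\ n^{-\gamma/2} & \text{in the subexponential case}.\end{cases}$$ Assume that, for every compact set $K\subset\mathbb R$ not containing $0$, $$\forall\varepsilon>0,\ \exists N>0,\quad \sup_{m>n\ge N}\ \sup_{\alpha\in K}\ \sup_{j\in\mathbb Z\setminus\{0\}}\left(\sum_{k=n}^m|\varphi_{X_k}(j\alpha)|^2\right)<\varepsilon .$$ Let $(a_k)_{k\ge 0}$ be a sequence of complex numbers such that $$\sum_{n\ge 1}\frac{\sqrt{\sum_{k\ge n}|a_k|^2}}{n\,c_n}<+\infty .$$ Then there exists a measurable set $\Omega_0$ with $\mathbb P(\Omega_0)=1$ such that for all $\omega\in\Omega_0$ and all $f\in B(\mathbb T)$ with $\int_{\mathbb T}f(t)\,dt=0$: for every $\alpha\in\mathbb R\setminus\{0\}$ the series $$F(\alpha,\omega)=\sum_{k=0}^\infty a_k f(\alpha X_k(\omega))$$ is well defined, the function $\alpha\mapsto F(\alpha,\omega)$ is continuous on $\mathbb R\setminus\{0\}$, and the series defining $F$ converges uniformly in $\alpha$ on every compact subset of $\mathbb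 R$ not containing $0$.
   Context: $\mathbb T=\mathbb R/\mathbb Z$, and functions on $\mathbb T$ are identified with $1$-periodic functions on $\mathbb R$. $B(\mathbb T)$ is the set of functions $f:\mathbb T\to\mathbb C$ of the form $f(\alpha)=\sum_{j\in\mathbb Z}\hat f(j)\exp(2i\pi\alpha j)$ with $$|||f|||:=\sum_{j\in\mathbb Z}|\hat f(j)|\sqrt{\log(|j|+3)}<+\infty .$$ For a real random variable $X$, $\varphi_X(t)=\mathbb E(e^{2i\pi tX})$ for $t\in\mathbb R$. The symbol $\mathcal O$ is understood as $k\to\infty$. The set $\Omega_0$ does not depend on $f$. *)

theory Defs
  imports "HOL-Probability.Probability" "HOL-Library.Landau_Symbols"
begin

text \<open>
  Functions on the circle $\mathbb R/\mathbb Z$ are 1-periodic functions on the reals.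
\<close>

definition fourier_coeff :: "(real \<Rightarrow> complex) \<Rightarrow> int \<Rightarrow> complex" where
  "fourier_coeff f j =
     integral {0..1} (\<lambda>t. f t * exp (- (2 * \<i> * of_real pi * of_real t * of_int j)))"

definition B_space :: "(real \<Rightarrow> complex) set" where
  "B_space = {f. (\<forall>x. f (x + 1) = f x) \<and>
     (\<lambda>j::int. cmod (fourier_coeff f j) * sqrt (ln (real_of_int \<bar>j\<bar> + 3))) summable_on UNIV \<and>
     (\<forall>\<alpha>. ((\<lambda>j::int. fourier_coeff f j * exp (2 * \<i> * of_real pi * of_real \<alpha> * of_int j))
             has_sum f \<alpha>) UNIV)}"

definition char_fun :: "'a measure \<Rightarrow> ('a \<Rightarrow> real) \<Rightarrow> real \<Rightarrow> complex" where
  "char_fun M X t = (\<integral>\<omega>. exp (2 * \<i> * of_real pi * of_real t * of_real (X \<omega>)) \<partial>M)"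

lemma char_fun_eq_char:
  assumes "X \<in> borel_measurable M"
  shows "char_fun M X t = char (distr M borel X) (2 * pi * t)"
  unfolding char_fun_def char_def
  by (subst integral_distr) (use assms in \<open>auto simp: mult_ac\<close>)

text \<open>
  The Bochner integral of a non-integrable function is 0 by convention, so finiteness of the
  moments has to be required separately. Like the \<open>O\<close>-bound, it constrains only large \<open>k\<close>.
\<close>

definition moment_bigo :: "'a measure \<Rightarrow> (nat \<Rightarrow> 'a \<Rightarrow> real) \<Rightarrow> real \<Rightarrow> (nat \<Rightarrow> real) \<Rightarrow> bool" where
  "moment_bigo M X \<beta> g \<longleftrightarrow>
     (\<forall>\<^sub>F k in sequentially. integrable M (\<lambda>\<omega>. \<bar>X k \<omega>\<bar> powr \<beta>)) \<and>
     (\<lambda>k. \<integral>\<omega>. \<bar>X k \<omega>\<bar> powr \<beta> \<partial>M) \<in> O(g)"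

definition polynomial_case :: "'a measure \<Rightarrow> (nat \<Rightarrow> 'a \<Rightarrow> real) \<Rightarrow> bool" where
  "polynomial_case M X \<longleftrightarrow> (\<exists>\<beta>>0. \<exists>d>0. moment_bigo M X \<beta> (\<lambda>k. real k powr d))"

definition subexponential_case :: "'a measure \<Rightarrow> (nat \<Rightarrow> 'a \<Rightarrow> real) \<Rightarrow> real \<Rightarrow> bool" where
  "subexponential_case M X \<gamma> \<longleftrightarrow>
     0 < \<gamma> \<and> \<gamma> < 1 \<and> (\<exists>\<beta>>0. moment_bigo M X \<beta> (\<lambda>k. 2 powr (real k powr \<gamma>)))"

definition random_series ::
  "(nat \<Rightarrow> complex) \<Rightarrow> (real \<Rightarrow> complex) \<Rightarrow> (nat \<Rightarrow> 'a \<Rightarrow> real) \<Rightarrow> real \<Rightarrow> 'a \<Rightarrow> complex" where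
  "random_series a f X \<alpha> \<omega> = (\<Sum>k. a k * f (\<alpha> * X k \<omega>))"

end

theory Submission
  imports Defs "HOL-Library.Nat_Bijection" "HOL-Real_Asymp.Real_Asymp"
begin

text \<open>
  By Markov and Borel--Cantelli, truncating \<open>X k\<close> at \<open>B k = (g k * k\<^sup>2) powr (1 / \<beta>)\<close>, where \<open>g\<close> is
  the moment bound, changes only finitely many terms almost surely. Split the indices into blocks
  \<open>{N m..<N (m + 1)}\<close> and let \<open>H m\<close> dominate the logarithms of \<open>N (m + 1)\<close> and of the truncation
  levels on the block. Hoeffding's inequality on a grid of mesh \<open>exp (- 2 * H m)\<close>, a union bound and a
  Lipschitz estimate bound the centred exponential sums
  \<open>\<Sum>k. a k * (exp (2\<pi>i t X k) - \<phi> k t)\<close> over every initial segment of the block,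
  simultaneously for all real \<open>t\<close>, by a constant times \<open>sqrt (R m * H m) * sqrt (ln (\<bar>t\<bar> + 3))\<close>,
  with \<open>R m\<close> the tail of \<open>\<Sum>k. \<bar>a k\<bar>\<^sup>2\<close>. The blocks \<open>N m = 2 ^ 2 ^ m\<close> (polynomial case) and
  \<open>N m = 2 ^ m\<close> (subexponential case) are those for which the hypothesis on \<open>a\<close> condenses to
  \<open>\<Sum>m. sqrt (R m * H m) < \<infinity>\<close>. The means are handled by Cauchy--Schwarz and the hypothesis on the
  characteristic functions. Taking \<open>t = j * \<alpha>\<close>, the factor \<open>sqrt (ln (\<bar>j\<bar> + 3))\<close> is exactly the
  weight in the norm of \<open>B_space\<close>, so summing over \<open>j\<close> gives a uniform Cauchy estimate.
\<close>

subsection \<open>Exponential sums of independent variables\<close>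

definition circ :: "real \<Rightarrow> complex" where
  "circ t = cis (2 * pi * t)"

lemma norm_circ [simp]: "norm (circ t) = 1"
  by (simp add: circ_def)

lemma circ_eq_exp: "circ t = exp (2 * \<i> * of_real pi * of_real t)"
  by (simp add: circ_def cis_conv_exp mult_ac)

lemma continuous_on_circ [continuous_intros]:
  "continuous_on A f \<Longrightarrow> continuous_on A (\<lambda>x. circ (f x))"
  unfolding circ_eq_exp by (intro continuous_intros)

lemma borel_measurable_circ [measurable]: "circ \<in> borel_measurable borel"
  by (intro borel_measurable_continuous_onI continuous_intros)

lemma norm_circ_diff_le: "norm (circ s - circ t) \<le> 2 * pi * \<bar>s - t\<bar>"
proof -
  have "circ s - circ t = circ t * (circ (s - t) - 1)"
    by (simp add: circ_def algebra_simps cis_mult)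
  moreover have "norm (circ (s - t) - 1) \<le> 2 * pi * \<bar>s - t\<bar>"
    using iexp_approx1[of "2 * pi * (s - t)" 0]
    by (simp add: circ_def cis_conv_exp abs_mult)
  ultimately show ?thesis by (simp add: norm_mult)
qed

lemma char_fun_circ: "char_fun M X t = (\<integral>\<omega>. circ (t * X \<omega>) \<partial>M)"
  by (simp add: char_fun_def circ_eq_exp mult_ac)

lemma one_le_ln_add_3: "ln (x + 3) \<ge> 1" if "x \<ge> 0" for x :: real
  using exp_le that by (subst ln_ge_iff) auto

text \<open>The encoding sends \<open>i \<ge> 0\<close> to \<open>2 * i\<close> and
  \<open>i < 0\<close> to \<open>-2 * i - 1\<close>. Enumerating the integer grid points by naturals
  therefore costs only an additive constant in the logarithm of the index.\<close>

lemma int_encode_le: "real (int_encode i) \<le> 2 * \<bar>of_int i\<bar>"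
  by (auto simp: int_encode_def sum_encode_def of_nat_nat)

context prob_space
begin

lemma integrable_circ [intro]:
  assumes [measurable]: "random_variable borel X"
  shows "integrable M (\<lambda>\<omega>. circ (t * X \<omega>))"
  by (rule integrable_const_bound[where B = 1]) auto

lemma norm_char_fun_diff_le:
  assumes [measurable]: "random_variable borel X" and "\<And>\<omega>. \<omega> \<in> space M \<Longrightarrow> \<bar>X \<omega>\<bar> \<le> b"
  shows "norm (char_fun M X s - char_fun M X t) \<le> 2 * pi * \<bar>s - t\<bar> * b"
proof -
  have "char_fun M X s - char_fun M X t = (\<integral>\<omega>. circ (s * X \<omega>) - circ (t * X \<omega>) \<partial>M)"
    unfolding char_fun_circ by (subst Bochner_Integration.integral_diff) auto
  also have "norm \<dots> \<le> (\<integral>\<omega>. norm (circ (s * X \<omega>) - circ (t * X \<omega>)) \<partial>M)"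
    by (rule integral_norm_bound)
  also have "\<dots> \<le> (\<integral>\<omega>. 2 * pi * \<bar>s - t\<bar> * b \<partial>M)"
  proof (rule integral_mono)
    fix \<omega> assume \<omega>: "\<omega> \<in> space M"
    have "norm (circ (s * X \<omega>) - circ (t * X \<omega>)) \<le> 2 * pi * (\<bar>s - t\<bar> * \<bar>X \<omega>\<bar>)"
      using norm_circ_diff_le[of "s * X \<omega>" "t * X \<omega>"]
      by (simp add: abs_mult flip: left_diff_distrib)
    also have "\<dots> \<le> 2 * pi * (\<bar>s - t\<bar> * b)"
      using assms(2)[OF \<omega>] by (intro mult_left_mono) auto
    finally show "norm (circ (s * X \<omega>) - circ (t * X \<omega>)) \<le> 2 * pi * \<bar>s - t\<bar> * b" by (simp add: mult_ac)
  qed (auto intro!: integrable_norm Bochner_Integration.integrable_diff)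
  also have "\<dots> = 2 * pi * \<bar>s - t\<bar> * b" by (simp add: prob_space)
  finally show ?thesis .
qed

text \<open>Hoeffding's inequality concerns real variables, so it is applied through a real
  functional \<open>h\<close>, later \<open>Re\<close> and \<open>Im\<close>. The summands
  \<open>h (a k * circ (t * X k \<omega>))\<close> lie in intervals of length
  \<open>2 * norm (a k)\<close>, which is where the factor 2 in the exponent comes from.\<close>

lemma Hoeffding_linear_functional:
  fixes X :: "nat \<Rightarrow> 'a \<Rightarrow> real" and a :: "nat \<Rightarrow> complex" and h :: "complex \<Rightarrow> real"
  assumes indep: "indep_vars (\<lambda>_. borel) X I" and "finite I"
    and h: "bounded_linear h" "\<And>z. \<bar>h z\<bar> \<le> norm z"
    and "\<epsilon> \<ge> 0" and V: "(\<Sum>k\<in>I. (norm (a k))\<^sup>2) \<le> V" "V > 0"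
  shows "prob {\<omega>\<in>space M. \<bar>h (\<Sum>k\<in>I. a k * (circ (t * X k \<omega>) - char_fun M (X k) t))\<bar> \<ge> \<epsilon>}
           \<le> 2 * exp (- \<epsilon>\<^sup>2 / (2 * V))"
\<comment> \<open>Hoeffding needs a positive sum of squared interval lengths. If it vanishes, the
  sum is identically 0: for \<open>\<epsilon> > 0\<close> the event is empty, and for
  \<open>\<epsilon> = 0\<close> the claimed bound is 2.\<close>
proof (cases "(\<Sum>k\<in>I. (norm (a k))\<^sup>2) = 0")
  case True
  with \<open>finite I\<close> have "\<forall>k\<in>I. a k = 0"
    by (subst (asm) sum_nonneg_eq_0_iff) auto
  hence z: "(\<Sum>k\<in>I. a k * (circ (t * X k \<omega>) - char_fun M (X k) t)) = 0" for \<omega>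
    by (simp add: sum.neutral)
  interpret h: bounded_linear h by fact
  show ?thesis
    using \<open>\<epsilon> \<ge> 0\<close> by (cases "\<epsilon> = 0") (simp_all add: z h.zero prob_space)
next
  case False
  interpret h: bounded_linear h by fact
  have [measurable]: "h \<in> borel_measurable borel"
    by (intro borel_measurable_continuous_onI linear_continuous_on h)
  have rv [measurable]: "random_variable borel (X k)" if "k \<in> I" for k
    using indep that by (simp add: indep_vars_def2)
  define Y where "Y = (\<lambda>k \<omega>. h (a k * circ (t * X k \<omega>)))"
  have indY: "indep_vars (\<lambda>_. borel) Y I"
    unfolding Y_def by (rule indep_vars_compose2[OF indep]) measurable
  have Yb: "\<bar>Y k \<omega>\<bar> \<le> norm (a k)" for k \<omega>
    using h(2)[of "a k * circ (t * X k \<omega>)"] by (simp add: Y_def norm_mult)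
  interpret H: Hoeffding_ineq M I Y "\<lambda>k. - norm (a k)" "\<lambda>k. norm (a k)" "\<Sum>k\<in>I. expectation (Y k)"
  proof unfold_locales
    fix k assume "k \<in> I"
    show "AE \<omega> in M. Y k \<omega> \<in> {- norm (a k)..norm (a k)}"
      using Yb[of k] by (intro AE_I2) (auto simp: abs_le_iff minus_le_iff)
  qed (use indY \<open>finite I\<close> in auto)
  have EY: "expectation (Y k) = h (a k * char_fun M (X k) t)" if "k \<in> I" for k
    unfolding Y_def char_fun_circ using rv[OF that]
    by (subst integral_bounded_linear[OF h(1)]) auto
  have eq: "h (\<Sum>k\<in>I. a k * (circ (t * X k \<omega>) - char_fun M (X k) t))
      = (\<Sum>k\<in>I. Y k \<omega>) - (\<Sum>k\<in>I. expectation (Y k))" for \<omega>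
    by (simp add: EY h.sum h.diff right_diff_distrib sum_subtractf) (simp add: Y_def)
  let ?S = "\<Sum>k\<in>I. (norm (a k))\<^sup>2"
  have Spos: "?S > 0" using False by (simp add: less_le sum_nonneg)
  have w: "(\<Sum>k\<in>I. (norm (a k) - - norm (a k))\<^sup>2) = 4 * ?S"
    by (simp add: sum_distrib_left power2_eq_square flip: mult_2)
  have "prob {\<omega>\<in>space M. \<bar>h (\<Sum>k\<in>I. a k * (circ (t * X k \<omega>) - char_fun M (X k) t))\<bar> \<ge> \<epsilon>}
      \<le> 2 * exp (- 2 * \<epsilon>\<^sup>2 / (4 * ?S))"
    unfolding eq w[symmetric] by (rule H.Hoeffding_ineq_abs_ge) (use Spos \<open>\<epsilon> \<ge> 0\<close> w in auto)
  also have "- 2 * \<epsilon>\<^sup>2 / (4 * ?S) \<le> - \<epsilon>\<^sup>2 / (2 * V)"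
  proof -
    have "\<epsilon>\<^sup>2 / (2 * V) \<le> \<epsilon>\<^sup>2 / (2 * ?S)"
      using Spos V by (intro divide_left_mono) auto
    thus ?thesis by simp
  qed
  finally show ?thesis by simp
qed

text \<open>Since the norm is at most the sum of the absolute values of the real and imaginary
  parts, one of these reaches \<open>\<epsilon>\<close> as soon as the norm reaches
  \<open>2 * \<epsilon>\<close>. The two events account for the factor 4.\<close>

lemma Hoeffding_complex:
  fixes X :: "nat \<Rightarrow> 'a \<Rightarrow> real" and a :: "nat \<Rightarrow> complex"
  assumes indep: "indep_vars (\<lambda>_. borel) X I" and "finite I"
    and "\<epsilon> \<ge> 0" and V: "(\<Sum>k\<in>I. (norm (a k))\<^sup>2) \<le> V" "V > 0"
  shows "prob {\<omega>\<in>space M. norm (\<Sum>k\<in>I. a k * (circ (t * X k \<omega>) - char_fun M (X k) t)) \<ge> 2 * \<epsilon>}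
           \<le> 4 * exp (- \<epsilon>\<^sup>2 / (2 * V))"
proof -
  let ?S = "\<lambda>\<omega>. \<Sum>k\<in>I. a k * (circ (t * X k \<omega>) - char_fun M (X k) t)"
  have [measurable]: "random_variable borel (X k)" if "k \<in> I" for k
    using indep that by (simp add: indep_vars_def2)
  have [measurable]: "?S \<in> borel_measurable M" by measurable
  let ?A = "{\<omega>\<in>space M. \<bar>Re (?S \<omega>)\<bar> \<ge> \<epsilon>}" and ?B = "{\<omega>\<in>space M. \<bar>Im (?S \<omega>)\<bar> \<ge> \<epsilon>}"
  have "prob {\<omega>\<in>space M. norm (?S \<omega>) \<ge> 2 * \<epsilon>} \<le> prob (?A \<union> ?B)"
  proof (rule finite_measure_mono)
    show "{\<omega>\<in>space M. norm (?S \<omega>) \<ge> 2 * \<epsilon>} \<subseteq> ?A \<union> ?B"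
    proof
      fix \<omega> assume "\<omega> \<in> {\<omega>\<in>space M. norm (?S \<omega>) \<ge> 2 * \<epsilon>}"
      with cmod_le[of "?S \<omega>"] show "\<omega> \<in> ?A \<union> ?B" by (auto simp del: Re_sum Im_sum)
    qed
  qed measurable
  also have "\<dots> \<le> prob ?A + prob ?B" by (rule measure_Un_le) measurable
  also have "\<dots> \<le> 2 * exp (- \<epsilon>\<^sup>2 / (2 * V)) + 2 * exp (- \<epsilon>\<^sup>2 / (2 * V))"
    by (intro add_mono Hoeffding_linear_functional assms bounded_linear_Re bounded_linear_Im
        abs_Re_le_cmod abs_Im_le_cmod)
  finally show ?thesis by simp
qed

section \<open>Block estimates that hold for all frequencies simultaneously\<close>

lemma AE_block_bound:
  fixes X :: "nat \<Rightarrow> 'a \<Rightarrow> real" and a :: "nat \<Rightarrow> complex" and N :: "nat \<Rightarrow> nat" and H R :: "nat \<Rightarrow> real"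
  assumes indep: "indep_vars (\<lambda>_. borel) X UNIV"
    and H1: "\<And>m. H m \<ge> 1" and sumH: "summable (\<lambda>m. exp (- H m))"
    and NH: "\<And>m. real (N (Suc m)) \<le> exp (H m)"
    and XH: "\<And>m k \<omega>. k < N (Suc m) \<Longrightarrow> \<omega> \<in> space M \<Longrightarrow> \<bar>X k \<omega>\<bar> \<le> exp (H m)"
    and R: "\<And>m p. (\<Sum>k\<in>{N m..<p}. (norm (a k))\<^sup>2) \<le> R m"
  shows "AE \<omega> in M. \<exists>m0. \<forall>m\<ge>m0. \<forall>p\<le>N (Suc m). \<forall>t.
           norm (\<Sum>k\<in>{N m..<p}. a k * (circ (t * X k \<omega>) - char_fun M (X k) t))
             \<le> 25 * sqrt (R m * H m) * sqrt (ln (\<bar>t\<bar> + 3))"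
proof -
  \<comment> \<open>Each centred partial sum is controlled on the grid of mesh \<open>exp (- 2 * H m)\<close>; the logarithmic weight in the
    grid index pays for the infinitely many grid points.\<close>
  define S where "S m p t \<omega> = (\<Sum>k\<in>{N m..<p}. a k * (circ (t * X k \<omega>) - char_fun M (X k) t))" for m p t \<omega>
  define \<delta> where "\<delta> m = exp (- 2 * H m)" for m
  \<comment> \<open>The 6 turns the Hoeffding exponent into \<open>- 3 * (H m + ln (n + 3))\<close>.
    The part in \<open>H m\<close> pays for the choice of \<open>p\<close> and for Borel--Cantelli
    over \<open>m\<close>, the part in \<open>n\<close> for the sum over the grid.\<close>
  define \<epsilon> where "\<epsilon> m n = sqrt (6 * R m * (H m + ln (real n + 3)))" for m n
  define A where "A m p n = {\<omega>\<in>space M. norm (S m p (of_int (int_decode n) * \<delta> m) \<omega>) \<ge> 2 * \<epsilon> m n}" for m p n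
  \<comment> \<open>For \<open>R m = 0\<close> the threshold is 0 and every \<open>A m p n\<close>
    would be the whole space. All coefficients from \<open>N m\<close> on vanish then, so nothing
    has to be excluded.\<close>
  define E where "E m = (if R m = 0 then {} else \<Union>p\<in>{..N (Suc m)}. \<Union>n. A m p n)" for m
  define w where "w n = inverse (real (n + 3) ^ 2)" for n
  have [measurable]: "random_variable borel (X k)" for k
    using indep by (simp add: indep_vars_def2)
  have [measurable]: "S m p t \<in> borel_measurable M" for m p t
    unfolding S_def by measurable
  have Aset [measurable]: "A m p n \<in> sets M" for m p n unfolding A_def by measurable
  have Eset [measurable]: "E m \<in> sets M" for m unfolding E_def by auto
  have R0: "R m \<ge> 0" for m using R[of m 0] by simp
  have sw: "summable w"
    unfolding w_def using inverse_power_summable[of 2, where ?'a = real]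
    by (intro summable_ignore_initial_segment[where f = "\<lambda>n. inverse (real n ^ 2)"]) simp_all
  have pA: "prob (A m p n) \<le> 4 * exp (- 3 * H m) * w n" if "R m > 0" for m p n
  proof -
    have "prob (A m p n) \<le> 4 * exp (- (\<epsilon> m n)\<^sup>2 / (2 * R m))"
      unfolding A_def S_def
      by (rule Hoeffding_complex)
         (use R that H1[of m] one_le_ln_add_3[of "real n"] in \<open>auto intro: indep_vars_subset[OF indep] simp: \<epsilon>_def\<close>)
    also have "(\<epsilon> m n)\<^sup>2 = 6 * R m * (H m + ln (real n + 3))"
      unfolding \<epsilon>_def using that H1[of m] one_le_ln_add_3[of "real n"] by (intro real_sqrt_pow2) auto
    also have "- (6 * R m * (H m + ln (real n + 3))) / (2 * R m) = - 3 * H m - 3 * ln (real n + 3)"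
      using that by (simp add: field_simps)
    \<comment> \<open>One of the three logarithms is given up: \<open>(n + 3)\<close> to the power
      -2 is already summable.\<close>
    also have "exp (- 3 * H m - 3 * ln (real n + 3)) \<le> exp (- 3 * H m + - (2 * ln (real n + 3)))"
      using one_le_ln_add_3[of "real n"] by simp
    also have "\<dots> = exp (- 3 * H m) * w n"
      unfolding exp_add by (simp add: w_def exp_minus exp_double add_ac)
    finally show ?thesis by simp
  qed
  have pU: "prob (\<Union>n. A m p n) \<le> 4 * exp (- 3 * H m) * suminf w" if "R m > 0" for m p
  proof -
    have s: "summable (\<lambda>n. prob (A m p n))"
      by (rule summable_comparison_test'[OF summable_mult[OF sw, of "4 * exp (- 3 * H m)"]])
         (use pA[OF that] in auto)
    have "prob (\<Union>n. A m p n) \<le> (\<Sum>n. prob (A m p n))"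
      by (rule finite_measure_subadditive_countably) (use s in auto)
    also have "\<dots> \<le> (\<Sum>n. 4 * exp (- 3 * H m) * w n)"
      by (intro suminf_le pA that s summable_mult sw)
    also have "\<dots> = 4 * exp (- 3 * H m) * suminf w" by (rule suminf_mult[OF sw])
    finally show ?thesis .
  qed
  have w0: "suminf w \<ge> 0" by (rule suminf_nonneg[OF sw]) (simp add: w_def)
  have pE: "prob (E m) \<le> (8 * suminf w) * exp (- H m)" for m
  proof (cases "R m = 0")
    case True thus ?thesis using w0 by (simp add: E_def)
  next
    case False
    with R0[of m] have pos: "R m > 0" by simp
    have "prob (E m) \<le> (\<Sum>p\<in>{..N (Suc m)}. prob (\<Union>n. A m p n))"
      using False unfolding E_def by (auto intro!: finite_measure_subadditive_finite)
    also have "\<dots> \<le> (\<Sum>p\<in>{..N (Suc m)}. 4 * exp (- 3 * H m) * suminf w)"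
      by (intro sum_mono pU pos)
    also have "\<dots> = (real (N (Suc m)) + 1) * (4 * exp (- 3 * H m) * suminf w)" by simp
    \<comment> \<open>The \<open>N (Suc m) + 1\<close> possible endpoints \<open>p\<close> use up
      one factor \<open>exp (H m)\<close> out of \<open>exp (- 3 * H m)\<close>.\<close>
    also have "\<dots> \<le> (2 * exp (H m)) * (4 * exp (- 3 * H m) * suminf w)"
      using NH[of m] H1[of m] w0 by (intro mult_right_mono) (auto simp: add_mono intro: order.trans[OF add_mono])
    also have "\<dots> = 8 * suminf w * exp (H m - 3 * H m)" 
    proof -
      have "exp (H m - 3 * H m) = exp (H m) * exp (- 3 * H m)" by (simp flip: exp_add)
      thus ?thesis by (simp only:) simp
    qed
    also have "\<dots> \<le> 8 * suminf w * exp (- H m)"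
      using w0 H1[of m] by (intro mult_left_mono) auto
    finally show ?thesis .
  qed
  have "AE \<omega> in M. eventually (\<lambda>m. \<omega> \<in> space M - E m) sequentially"
  proof (rule borel_cantelli_AE1)
    show "summable (\<lambda>m. prob (E m))"
      by (rule summable_comparison_test'[OF summable_mult[OF sumH, of "8 * suminf w"]]) (use pE in auto)
  qed (auto simp: less_top[symmetric])
  thus ?thesis
  proof eventually_elim
    case (elim \<omega>)
    then obtain m0 where m0: "\<And>m. m \<ge> m0 \<Longrightarrow> \<omega> \<in> space M - E m"
      by (auto simp: eventually_sequentially)
    have "norm (S m p t \<omega>) \<le> 25 * sqrt (R m * H m) * sqrt (ln (\<bar>t\<bar> + 3))"
      if m: "m \<ge> m0" and p: "p \<le> N (Suc m)" for m p t
    proof (cases "R m = 0")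
      case True
      hence "(\<Sum>k\<in>{N m..<p}. (norm (a k))\<^sup>2) = 0"
        using R[of m p] by (simp add: order.antisym sum_nonneg)
      hence "\<forall>k\<in>{N m..<p}. a k = 0" by (subst (asm) sum_nonneg_eq_0_iff) auto
      hence "S m p t \<omega> = 0" unfolding S_def by (intro sum.neutral) auto
      thus ?thesis using True by simp
    next
      case False
      with R0[of m] have pos: "R m > 0" by simp
      have \<omega>: "\<omega> \<in> space M" using m0[OF m] by simp
      \<comment> \<open>The grid point \<open>s = i * \<delta> m\<close> is the nearest one to the
        left of \<open>t\<close>, and \<open>n\<close> is its index in the enumeration.\<close>
      define i where "i = \<lfloor>t / \<delta> m\<rfloor>"
      define n where "n = int_encode i"
      define s where "s = of_int i * \<delta> m"
      define L where "L = ln (\<bar>t\<bar> + 3)"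
      have L: "L \<ge> 1" unfolding L_def by (rule one_le_ln_add_3) simp
      have \<delta>: "\<delta> m > 0" "\<delta> m \<le> 1" using H1[of m] by (simp_all add: \<delta>_def)
      have i1: "of_int i \<le> t / \<delta> m" "t / \<delta> m \<le> of_int i + 1"
        unfolding i_def by linarith+
      have st: "\<bar>t - s\<bar> \<le> \<delta> m"
        using i1 \<delta> by (simp add: s_def field_simps abs_le_iff)
      have "\<omega> \<notin> A m p n" using m0[OF m] False p by (auto simp: E_def)
      hence Ss: "norm (S m p s \<omega>) \<le> 2 * \<epsilon> m n" using \<omega> by (simp add: A_def n_def s_def)
      have "real n \<le> 2 * \<bar>of_int i\<bar>" unfolding n_def by (rule int_encode_le)
      also have "\<bar>of_int i\<bar> \<le> \<bar>t\<bar> / \<delta> m + 1"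
        using i1 \<delta> by (simp add: abs_le_iff) (smt (verit) abs_ge_self abs_ge_minus_self divide_right_mono minus_divide_left)
      finally have n1: "real n \<le> 2 * \<bar>t\<bar> / \<delta> m + 2" by simp
      have "real n + 3 \<le> 2 * (\<bar>t\<bar> + 3) / \<delta> m"
      proof -
        have "6 \<le> 6 / \<delta> m" using \<delta> by (simp add: field_simps)
        thus ?thesis using n1 by (simp add: add_divide_distrib)
      qed
      hence "ln (real n + 3) \<le> ln (2 * (\<bar>t\<bar> + 3) / \<delta> m)" using \<delta> by (intro ln_mono) auto
      also have "2 * (\<bar>t\<bar> + 3) / \<delta> m = exp (ln 2 + L + 2 * H m)"
        unfolding exp_add L_def \<delta>_def by (simp add: exp_minus field_simps)
      also have "ln \<dots> = ln 2 + L + 2 * H m" by simp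
      finally have "H m + ln (real n + 3) \<le> 4 * H m + L"
        using ln_2_less_1 H1[of m] by linarith
      \<comment> \<open>Both \<open>H m\<close> and \<open>L\<close> are at least 1, so their
        product dominates each of them. This makes the bound multiplicative in the block and the
        frequency.\<close>
      also have "\<dots> \<le> 4 * (H m * L) + H m * L"
        using H1[of m] L mult_left_mono[of 1 L "H m"] mult_right_mono[of 1 "H m" L] by (intro add_mono) auto
      finally have hl: "H m + ln (real n + 3) \<le> 5 * (H m * L)" by linarith
      \<comment> \<open>The constant 5 is enlarged to 6 to obtain a perfect square.\<close>
      have "\<epsilon> m n \<le> sqrt (36 * ((R m * H m) * L))"
        unfolding \<epsilon>_def
      proof (rule real_sqrt_le_mono)
        have "6 * R m * (H m + ln (real n + 3)) \<le> 6 * R m * (6 * (H m * L))"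
          using pos hl H1[of m] L by (intro mult_left_mono) (auto intro: order.trans[OF hl])
        thus "6 * R m * (H m + ln (real n + 3)) \<le> 36 * ((R m * H m) * L)" by (simp add: mult_ac)
      qed
      also have "\<dots> = 6 * (sqrt (R m * H m) * sqrt L)"
        by (simp add: real_sqrt_mult)
      finally have e: "2 * \<epsilon> m n \<le> 12 * (sqrt (R m * H m) * sqrt L)" by linarith
      have ak: "norm (a k) \<le> sqrt (R m)" if "k \<in> {N m..<p}" for k
      proof -
        have "(norm (a k))\<^sup>2 \<le> (\<Sum>k\<in>{N m..<p}. (norm (a k))\<^sup>2)"
          by (rule member_le_sum) (use that in auto)
        also note R
        finally show ?thesis by (simp add: real_le_rsqrt)
      qed
      have Yk: "norm ((circ (t * X k \<omega>) - char_fun M (X k) t) - (circ (s * X k \<omega>) - char_fun M (X k) s))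
            \<le> 4 * pi * \<delta> m * exp (H m)" if "k \<in> {N m..<p}" for k
      proof -
        have b: "\<bar>X k \<omega>\<bar> \<le> exp (H m)" if "\<omega> \<in> space M" for \<omega>
          using XH[of k m \<omega>] \<open>k \<in> _\<close> p that by auto
        have "norm (circ (t * X k \<omega>) - circ (s * X k \<omega>)) \<le> 2 * pi * (\<bar>t - s\<bar> * \<bar>X k \<omega>\<bar>)"
          using norm_circ_diff_le[of "t * X k \<omega>" "s * X k \<omega>"] by (simp add: abs_mult flip: left_diff_distrib)
        also have "\<dots> \<le> 2 * pi * (\<delta> m * exp (H m))"
          using st b[OF \<omega>] by (intro mult_left_mono mult_mono) auto
        finally have 1: "norm (circ (t * X k \<omega>) - circ (s * X k \<omega>)) \<le> 2 * pi * (\<delta> m * exp (H m))" .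
        have "norm (char_fun M (X k) t - char_fun M (X k) s) \<le> 2 * pi * \<bar>t - s\<bar> * exp (H m)"
          by (rule norm_char_fun_diff_le) (use b in auto)
        also have "\<dots> \<le> 2 * pi * \<delta> m * exp (H m)"
          using st by (intro mult_left_mono mult_right_mono) auto
        finally have 2: "norm (char_fun M (X k) t - char_fun M (X k) s) \<le> 2 * pi * \<delta> m * exp (H m)" .
        have "norm ((circ (t * X k \<omega>) - char_fun M (X k) t) - (circ (s * X k \<omega>) - char_fun M (X k) s))
           = norm ((circ (t * X k \<omega>) - circ (s * X k \<omega>)) - (char_fun M (X k) t - char_fun M (X k) s))"
          by (simp add: algebra_simps)
        also have "\<dots> \<le> norm (circ (t * X k \<omega>) - circ (s * X k \<omega>)) + norm (char_fun M (X k) t - char_fun M (X k) s)"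
          by (rule norm_triangle_ineq4)
        finally show ?thesis using 1 2 by (simp add: mult_ac)
      qed
      have "norm (S m p t \<omega> - S m p s \<omega>) \<le> (\<Sum>k\<in>{N m..<p}. sqrt (R m) * (4 * pi * \<delta> m * exp (H m)))"
        unfolding S_def sum_subtractf[symmetric] right_diff_distrib[symmetric]
        by (intro sum_norm_le) (auto simp: norm_mult R0 intro!: mult_mono ak Yk)
      also have "\<dots> = real (p - N m) * (sqrt (R m) * (4 * pi * \<delta> m * exp (H m)))" by simp
      \<comment> \<open>There are at most \<open>exp (H m)\<close> terms, each with a Lipschitz
        constant of order \<open>exp (H m)\<close>; the mesh \<open>exp (- 2 * H m)\<close> cancels
        both factors.\<close>
      also have "\<dots> \<le> exp (H m) * (sqrt (R m) * (4 * pi * \<delta> m * exp (H m)))"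
        using NH[of m] p R0[of m] \<delta> by (intro mult_right_mono) auto
      also have "\<dots> = 4 * pi * sqrt (R m)"
      proof -
        have "exp (H m) * \<delta> m * exp (H m) = 1" by (simp add: \<delta>_def flip: exp_add)
        thus ?thesis by (metis (no_types, opaque_lifting) mult.assoc mult.commute mult.left_commute mult_1)
      qed
      \<comment> \<open>Here \<open>4 * pi < 13\<close>. With the 12 from the grid point, this gives
        the 25 of the statement.\<close>
      also have "\<dots> \<le> 13 * sqrt (R m)"
        using pi_less_4 pi_approx R0[of m] by (intro mult_right_mono) auto
      also have "sqrt (R m) \<le> sqrt (R m * H m) * sqrt L"
      proof -
        have "sqrt (R m) * 1 * 1 \<le> sqrt (R m) * sqrt (H m) * sqrt L"
          using H1[of m] L R0[of m] by (intro mult_mono) auto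
        thus ?thesis by (simp add: real_sqrt_mult)
      qed
      finally have "norm (S m p t \<omega> - S m p s \<omega>) \<le> 13 * (sqrt (R m * H m) * sqrt L)" by simp
      moreover have "norm (S m p t \<omega>) \<le> norm (S m p s \<omega>) + norm (S m p t \<omega> - S m p s \<omega>)"
        using norm_triangle_ineq[of "S m p s \<omega>" "S m p t \<omega> - S m p s \<omega>"] by simp
      ultimately show ?thesis using Ss e by (simp add: L_def)
    qed
    thus ?case unfolding S_def by blast
  qed
qed

end

subsection \<open>Truncation\<close>

context prob_space
begin

text \<open>The integrand vanishes where the variables agree and is at most 2 elsewhere. This
  transfers the hypothesis on the characteristic functions to the truncated variables.\<close>

lemma norm_char_fun_diff_le_prob:
  assumes [measurable]: "random_variable borel X" "random_variable borel Y"
  shows "norm (char_fun M X t - char_fun M Y t) \<le> 2 * prob {\<omega>\<in>space M. X \<omega> \<noteq> Y \<omega>}"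
proof -
  let ?D = "{\<omega>\<in>space M. X \<omega> \<noteq> Y \<omega>}"
  have "char_fun M X t - char_fun M Y t = (\<integral>\<omega>. circ (t * X \<omega>) - circ (t * Y \<omega>) \<partial>M)"
    unfolding char_fun_circ by (subst Bochner_Integration.integral_diff) auto
  also have "norm \<dots> \<le> (\<integral>\<omega>. norm (circ (t * X \<omega>) - circ (t * Y \<omega>)) \<partial>M)"
    by (rule integral_norm_bound)
  also have "\<dots> \<le> (\<integral>\<omega>. 2 * indicator ?D \<omega> \<partial>M)"
  proof (rule integral_mono)
    fix \<omega> assume \<omega>: "\<omega> \<in> space M"
    show "norm (circ (t * X \<omega>) - circ (t * Y \<omega>)) \<le> 2 * indicator ?D \<omega>"
      using \<omega> norm_triangle_ineq4[of "circ (t * X \<omega>)" "circ (t * Y \<omega>)"] by (auto simp: indicator_def)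
  qed (auto intro!: integrable_norm Bochner_Integration.integrable_diff integrable_real_indicator simp: less_top[symmetric])
  also have "\<dots> = 2 * prob ?D" by simp
  finally show ?thesis .
qed

text \<open>Markov's inequality for \<open>\<bar>X k\<bar> powr \<beta>\<close> at level
  \<open>g k * k^2\<close>: the moment bound cancels \<open>g k\<close>, and the summable
  \<open>C / k^2\<close> remains. Positivity of \<open>g\<close> is asked from \<open>k = 1\<close>
  on because \<open>k powr d\<close> is 0 at \<open>k = 0\<close>.\<close>

lemma moment_bigo_imp_summable_tail:
  assumes "moment_bigo M X \<beta> g" and "\<beta> > 0" and g: "\<And>k. k \<ge> 1 \<Longrightarrow> g k > 0"
    and [measurable]: "\<And>k. random_variable borel (X k)"
  shows "summable (\<lambda>k. prob {\<omega>\<in>space M. (g k * real k ^ 2) powr (1 / \<beta>) < \<bar>X k \<omega>\<bar>})"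
proof -
  let ?E = "\<lambda>k. \<integral>\<omega>. \<bar>X k \<omega>\<bar> powr \<beta> \<partial>M"
  obtain C where C: "C > 0" "\<forall>\<^sub>F k in sequentially. norm (?E k) \<le> C * norm (g k)"
    using assms(1) unfolding moment_bigo_def by (auto elim: landau_o.bigE)
  have int: "\<forall>\<^sub>F k in sequentially. integrable M (\<lambda>\<omega>. \<bar>X k \<omega>\<bar> powr \<beta>)"
    using assms(1) unfolding moment_bigo_def by blast
  have "\<forall>\<^sub>F k in sequentially. norm (prob {\<omega>\<in>space M. (g k * real k ^ 2) powr (1 / \<beta>) < \<bar>X k \<omega>\<bar>})
          \<le> C * inverse (real k ^ 2)"
    using C(2) int eventually_ge_at_top[of 1]
  proof eventually_elim
    case (elim k)
    define b where "b = g k * real k ^ 2"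
    have b: "b > 0" using g[of k] elim by (simp add: b_def)
    have "prob {\<omega>\<in>space M. b powr (1 / \<beta>) < \<bar>X k \<omega>\<bar>} \<le> prob {\<omega>\<in>space M. b \<le> \<bar>X k \<omega>\<bar> powr \<beta>}"
    proof (rule finite_measure_mono)
      show "{\<omega>\<in>space M. b powr (1 / \<beta>) < \<bar>X k \<omega>\<bar>} \<subseteq> {\<omega>\<in>space M. b \<le> \<bar>X k \<omega>\<bar> powr \<beta>}"
      proof safe
        fix \<omega> assume "b powr (1 / \<beta>) < \<bar>X k \<omega>\<bar>"
        hence "(b powr (1 / \<beta>)) powr \<beta> \<le> \<bar>X k \<omega>\<bar> powr \<beta>"
          using \<open>\<beta> > 0\<close> by (intro powr_mono2) auto
        thus "b \<le> \<bar>X k \<omega>\<bar> powr \<beta>" using b \<open>\<beta> > 0\<close> by (simp add: powr_powr)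
      qed
    qed measurable
    also have "\<dots> \<le> ?E k / b"
      by (rule integral_Markov_inequality_measure[where A = "{}"]) (use elim b in auto)
    also have "\<dots> \<le> C * g k / b"
      using elim g[of k] b by (intro divide_right_mono) auto
    also have "\<dots> = C * inverse (real k ^ 2)"
      using g[of k] elim by (simp add: b_def divide_simps)
    finally show ?case by (simp add: b_def)
  qed
  thus ?thesis
    by (rule summable_comparison_test_ev) (intro summable_mult inverse_power_summable, simp)
qed

end

subsection \<open>Choice of the blocks\<close>

lemma ln_ratio_le_sum_inverse:
  assumes "1 \<le> m" "m \<le> n"
  shows "ln (real n / real m) \<le> (\<Sum>k\<in>{m..<n}. 1 / real k)"
  using assms(2)
proof (induction rule: dec_induct)
  case base
  show ?case by simp
next
  case (step n)
  have n: "real n > 0" using assms(1) step by simp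
  have "ln (1 + 1 / real n) \<le> 1 / real n" by (rule ln_add_one_self_le_self) simp
  moreover have "1 + 1 / real n = real (Suc n) / real n" using n by (simp add: field_simps)
  ultimately have "ln (real (Suc n) / real n) \<le> 1 / real n" by simp
  moreover have "ln (real (Suc n) / real m) = ln (real n / real m) + ln (real (Suc n) / real n)"
    using n assms by (simp add: ln_div)
  ultimately show ?case using step by simp
qed

text \<open>Cauchy condensation. On block \<open>m\<close>, \<open>1 / c n\<close> is at least
  \<open>q m\<close> and \<open>R n\<close> is at least its value at the right end
  \<open>N (Suc m)\<close>, while the harmonic sum is at least \<open>ln (N (Suc m) / N m)\<close>.
  Block \<open>m\<close> thus dominates the term of index \<open>Suc m\<close>, and the shift of
  index does not affect summability.\<close>

lemma summable_condensed:
  fixes N :: "nat \<Rightarrow> nat" and R H q c :: "nat \<Rightarrow> real"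
  assumes N: "\<And>m. N m \<le> N (Suc m)" "N 0 \<ge> 1"
    and R: "\<And>m n. m \<le> n \<Longrightarrow> R n \<le> R m" "\<And>n. R n \<ge> 0"
    and c: "\<And>n. n \<ge> 1 \<Longrightarrow> c n > 0"
    and sm: "(\<lambda>n. sqrt (R n) / (real n * c n)) summable_on {1..}"
    and q: "\<And>m n. N m \<le> n \<Longrightarrow> n < N (Suc m) \<Longrightarrow> q m * c n \<le> 1" "\<And>m. q m \<ge> 0"
    and \<kappa>: "\<kappa> > 0" "\<And>m. \<kappa> * sqrt (H (Suc m)) \<le> q m * ln (real (N (Suc m)) / real (N m))"
    and H: "\<And>m. H m \<ge> 0"
  shows "summable (\<lambda>m. sqrt (R (N m) * H m))"
proof -
  define u where "u n = sqrt (R n) / (real n * c n)" for n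
  have N1: "N m \<ge> 1" for m
    by (induction m) (use N in \<open>auto intro: order.trans\<close>)
  have u0: "u n \<ge> 0" if "n \<ge> 1" for n using c[OF that] R(2)[of n] by (simp add: u_def)
  have block: "\<kappa> * sqrt (R (N (Suc m)) * H (Suc m)) \<le> sum u {N m..<N (Suc m)}" for m
  proof -
    have "\<kappa> * sqrt (R (N (Suc m)) * H (Suc m)) = sqrt (R (N (Suc m))) * (\<kappa> * sqrt (H (Suc m)))"
      by (simp add: real_sqrt_mult)
    also have "\<dots> \<le> sqrt (R (N (Suc m))) * (q m * ln (real (N (Suc m)) / real (N m)))"
      by (intro mult_left_mono \<kappa>) (simp add: R)
    also have "\<dots> \<le> sqrt (R (N (Suc m))) * (q m * (\<Sum>n\<in>{N m..<N (Suc m)}. 1 / real n))"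
      by (intro mult_left_mono ln_ratio_le_sum_inverse q N N1) (simp add: R)
    also have "\<dots> = (\<Sum>n\<in>{N m..<N (Suc m)}. sqrt (R (N (Suc m))) * q m * (1 / real n))"
      by (simp only: sum_distrib_left mult.assoc)
    also have "\<dots> \<le> sum u {N m..<N (Suc m)}"
    proof (rule sum_mono)
      fix n assume n: "n \<in> {N m..<N (Suc m)}"
      have n1: "n \<ge> 1" using N1[of m] n by simp
      have "q m \<le> 1 / c n" using q(1)[of m n] n c[OF n1] by (simp add: field_simps)
      moreover have "sqrt (R (N (Suc m))) \<le> sqrt (R n)" using R(1)[of n "N (Suc m)"] n by simp
      ultimately have "sqrt (R (N (Suc m))) * q m * (1 / real n) \<le> sqrt (R n) * (1 / c n) * (1 / real n)"
        using q(2)[of m] R(2) c[OF n1] by (intro mult_mono mult_nonneg_nonneg) (auto simp: less_imp_le)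
      thus "sqrt (R (N (Suc m))) * q m * (1 / real n) \<le> u n" by (simp add: u_def mult_ac)
    qed
    finally show ?thesis .
  qed
  have tot: "(\<Sum>m<M'. sum u {N m..<N (Suc m)}) = sum u {N 0..<N M'}" for M'
  proof (induction M')
    case (Suc M')
    have "N 0 \<le> N M'" using N by (induction M') (auto intro: order.trans)
    thus ?case using Suc N(1)[of M'] by (simp add: sum.atLeastLessThan_concat)
  qed simp
  have "summable (\<lambda>m. \<kappa> * sqrt (R (N (Suc m)) * H (Suc m)))"
  proof (rule summableI_nonneg_bounded)
    show "0 \<le> \<kappa> * sqrt (R (N (Suc m)) * H (Suc m))" for m using \<kappa>(1) R(2) H by simp
    fix M' :: nat
    have "(\<Sum>m<M'. \<kappa> * sqrt (R (N (Suc m)) * H (Suc m))) \<le> (\<Sum>m<M'. sum u {N m..<N (Suc m)})"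
      by (intro sum_mono block)
    also note tot
    also have "sum u {N 0..<N M'} \<le> infsum u {1..}"
      by (rule finite_sum_le_infsum) (use sm N(2) u0 in \<open>auto simp: u_def[abs_def]\<close>)
    finally show "(\<Sum>m<M'. \<kappa> * sqrt (R (N (Suc m)) * H (Suc m))) \<le> infsum u {1..}" .
  qed
  hence "summable (\<lambda>m. sqrt (R (N (Suc m)) * H (Suc m)))"
    using \<kappa>(1) by (simp add: summable_cmult_iff)
  thus ?thesis by (subst (asm) summable_Suc_iff)
qed

text \<open>On the doubly exponential blocks the logarithmic length is of order \<open>2 ^ m\<close>
  and \<open>c\<close> is at most of order \<open>sqrt (2 ^ m)\<close>. Their quotient has the order
  of \<open>sqrt (H m)\<close>, as condensation requires.\<close>

lemma polynomial_blocks: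
  fixes R c :: "nat \<Rightarrow> real" and d \<beta> :: real
  assumes pos: "d > 0" "\<beta> > 0"
    and c: "\<And>n. n \<ge> 1 \<Longrightarrow> c n = 1 + sqrt (ln (real n))"
    and R: "\<And>m n. m \<le> n \<Longrightarrow> R n \<le> R m" "\<And>n. R n \<ge> 0"
    and sm: "(\<lambda>n. sqrt (R n) / (real n * c n)) summable_on {1..}"
  shows "\<exists>(N :: nat \<Rightarrow> nat) H. strict_mono N \<and> (\<forall>m. H m \<ge> 1 \<and> H m \<ge> real m \<and> real (N (Suc m)) \<le> exp (H m)) \<and>
           (\<forall>m k. k < N (Suc m) \<longrightarrow> (real k powr d * real k ^ 2) powr (1 / \<beta>) \<le> exp (H m)) \<and>
           summable (\<lambda>m. sqrt (R (N m) * H m))"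
proof -
  \<comment> \<open>The first summand covers \<open>ln (N (Suc m)) = 2 * 2 ^ m * ln 2\<close>, the
    second the logarithm \<open>(d + 2) / \<beta> * ln k\<close> of the truncation level.\<close>
  define Q where "Q = 2 + 2 * (d + 2) / \<beta>"
  define N :: "nat \<Rightarrow> nat" where "N m = 2 ^ (2 ^ m)" for m
  define H where "H m = Q * 2 ^ m" for m
  have Q: "Q \<ge> 2" "Q \<ge> 2 * (d + 2) / \<beta>" using pos by (simp_all add: Q_def)
  have lnN: "ln (real (N m)) = 2 ^ m * ln 2" for m by (simp add: N_def ln_realpow)
  have H2: "H m \<ge> 2 * 2 ^ m" for m using Q by (simp add: H_def)
  have p1: "(2::real) ^ m \<ge> 1" "(2::real) ^ m \<ge> real m" for m
    by (simp_all add: less_imp_le)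
  have sN: "strict_mono N" by (rule strict_monoI) (simp add: N_def)
  have NH: "real (N (Suc m)) \<le> exp (H m)" for m
  proof -
    have "2 ^ Suc m * ln 2 \<le> (2 ^ Suc m * 1 :: real)"
      using ln_2_less_1 by (intro mult_left_mono) auto
    also have "\<dots> \<le> H m" using H2[of m] by simp
    finally have "2 ^ Suc m * ln 2 \<le> H m" .
    hence "exp (ln (real (N (Suc m)))) \<le> exp (H m)" by (simp only: lnN exp_le_cancel_iff)
    thus ?thesis by (simp add: N_def)
  qed
  have BH: "(real k powr d * real k ^ 2) powr (1 / \<beta>) \<le> exp (H m)" if k: "k < N (Suc m)" for m k
  proof (cases "k = 0")
    case False
    have "ln (real k) \<le> ln (real (N (Suc m)))" using k False by simp
    also have "\<dots> \<le> 2 * 2 ^ m * 1" unfolding lnN using ln_2_less_1 by (simp add: mult_left_le)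
    finally have lk: "ln (real k) \<le> 2 * 2 ^ m" by simp
    have "(real k powr d * real k ^ 2) powr (1 / \<beta>) = exp ((d + 2) / \<beta> * ln (real k))"
      using False by (simp add: powr_def ln_mult ln_realpow algebra_simps add_divide_distrib flip: exp_add exp_of_nat_mult)
    also have "(d + 2) / \<beta> * ln (real k) \<le> (d + 2) / \<beta> * (2 * 2 ^ m)"
      using lk pos by (intro mult_left_mono) auto
    also have "\<dots> = (2 * (d + 2) / \<beta>) * 2 ^ m" by simp
    also have "\<dots> \<le> H m" unfolding H_def using Q by (intro mult_right_mono) auto
    finally show ?thesis by simp
  qed simp
  have "summable (\<lambda>m. sqrt (R (N m) * H m))"
  \<comment> \<open>\<open>q m\<close> is the reciprocal of the bound
    \<open>2 * sqrt (2 ^ Suc m)\<close> for \<open>c\<close> on the block, and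
    \<open>\<kappa>\<close> is chosen to turn the condensation inequality into an equality.\<close>
  proof (rule summable_condensed[OF _ _ R _ sm, where q = "\<lambda>m. 1 / (2 * sqrt (2 ^ Suc m))" and \<kappa> = "ln 2 / (4 * sqrt Q)"])
    show "N m \<le> N (Suc m)" for m using sN by (simp add: strict_mono_less_eq)
    show "1 \<le> N 0" by (simp add: N_def)
    show "0 < c n" if "n \<ge> 1" for n using c[OF that] that by (simp add: add_pos_nonneg)
    show "1 / (2 * sqrt (2 ^ Suc m)) * c n \<le> 1" if n: "N m \<le> n" "n < N (Suc m)" for m n
    proof -
      have n1: "n \<ge> 1" using n by (auto simp: N_def intro: order.trans[rotated])
      have "ln (real n) \<le> ln (real (N (Suc m)))" using n n1 by simp
      also have "\<dots> \<le> 2 ^ Suc m" unfolding lnN using ln_2_less_1 by (simp add: mult_left_le)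
      finally have "sqrt (ln (real n)) \<le> sqrt (2 ^ Suc m)" by simp
      moreover have "1 \<le> sqrt (2 ^ Suc m :: real)" using p1(1)[of "Suc m"] by simp
      ultimately have "c n \<le> 2 * sqrt (2 ^ Suc m)" unfolding c[OF n1] by linarith
      thus ?thesis by (simp add: field_simps)
    qed
    show "ln 2 / (4 * sqrt Q) * sqrt (H (Suc m))
        \<le> 1 / (2 * sqrt (2 ^ Suc m)) * ln (real (N (Suc m)) / real (N m))" for m
    proof -
      define s where "s = sqrt (2 ^ Suc m :: real)"
      have s: "s > 0" "s * s = 2 * 2 ^ m" by (simp_all add: s_def)
      have "ln (real (N (Suc m)) / real (N m)) = 2 ^ m * ln 2"
        by (simp add: ln_div lnN N_def[of "Suc m"] N_def[of m] flip: lnN) (simp add: ln_realpow)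
      also have "\<dots> = s * s * ln 2 / 2" by (simp add: s(2))
      finally have "1 / (2 * s) * ln (real (N (Suc m)) / real (N m)) = s * ln 2 / 4"
        using s(1) by (simp add: field_simps)
      moreover have "ln 2 / (4 * sqrt Q) * sqrt (H (Suc m)) = s * ln 2 / 4"
        using Q(1) by (simp add: H_def s_def real_sqrt_mult)
      ultimately show ?thesis by (simp add: s_def)
    qed
    show "H m \<ge> 0" for m using H2[of m] by (rule order.trans[rotated]) simp
  qed (use Q in auto)
  moreover have "H m \<ge> 1" "H m \<ge> real m" for m using H2[of m] p1[of m] by linarith+
  ultimately show ?thesis using sN NH BH by blast
qed

text \<open>On dyadic blocks the logarithmic length is the constant \<open>ln 2\<close>, and
  \<open>1 / c n\<close> is at least \<open>N m powr (\<gamma> / 2)\<close>. This has the order of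
  \<open>sqrt (H m)\<close>, since \<open>H m\<close> is a multiple of
  \<open>2 powr (\<gamma> * m) = N m powr \<gamma>\<close>.\<close>

lemma subexponential_blocks:
  fixes R c :: "nat \<Rightarrow> real" and \<gamma> \<beta> :: real
  assumes pos: "0 < \<gamma>" "\<gamma> < 1" "\<beta> > 0"
    and c: "\<And>n. n \<ge> 1 \<Longrightarrow> c n = real n powr (- \<gamma> / 2)"
    and R: "\<And>m n. m \<le> n \<Longrightarrow> R n \<le> R m" "\<And>n. R n \<ge> 0"
    and sm: "(\<lambda>n. sqrt (R n) / (real n * c n)) summable_on {1..}"
  shows "\<exists>(N :: nat \<Rightarrow> nat) H. strict_mono N \<and> (\<forall>m. H m \<ge> 1 \<and> H m \<ge> real m \<and> real (N (Suc m)) \<le> exp (H m)) \<and>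
           (\<forall>m k. k < N (Suc m) \<longrightarrow> (2 powr (real k powr \<gamma>) * real k ^ 2) powr (1 / \<beta>) \<le> exp (H m)) \<and>
           summable (\<lambda>m. sqrt (R (N m) * H m))"
proof -
  define P where "P m = 2 powr (\<gamma> * real m)" for m
  have P1: "P m \<ge> 1" for m unfolding P_def using pos by (intro ge_one_powr_ge_zero) auto
  \<comment> \<open>\<open>ln (N (Suc m))\<close> is linear in \<open>m\<close>, hence at most a
    constant \<open>K\<close> times the exponential \<open>P m\<close>.\<close>
  have "(\<lambda>m. real (Suc m) / P m) \<longlonglongrightarrow> 0" unfolding P_def using pos(1) by real_asymp
  hence "Bseq (\<lambda>m. real (Suc m) / P m)" by (intro convergent_imp_Bseq) (auto simp: convergent_def)
  then obtain K where K0: "K > 0" "\<And>m. norm (real (Suc m) / P m) \<le> K" by (auto elim: BseqE)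
  have K: "real (Suc m) \<le> K * P m" for m
    using K0(2)[of m] P1[of m] by (simp add: field_simps)
  \<comment> \<open>\<open>1 + K\<close> makes \<open>H m\<close> exceed \<open>1 + Suc m\<close>;
    the last summand covers the logarithm
    \<open>(k powr \<gamma> * ln 2 + 2 * ln k) / \<beta>\<close> of the truncation level.\<close>
  define Q where "Q = 1 + K + (2 + 2 * K) / \<beta>"
  define N :: "nat \<Rightarrow> nat" where "N m = 2 ^ m" for m
  define H where "H m = Q * P m" for m
  have Q: "Q \<ge> 1 + K" "Q \<ge> (2 + 2 * K) / \<beta>" "Q > 0"
    using pos K0(1) by (simp_all add: Q_def add_pos_nonneg)
  have lnN: "ln (real (N m)) = real m * ln 2" for m by (simp add: N_def ln_realpow)
  have HK: "H m \<ge> 1 + real (Suc m)" for m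
  proof -
    have "(1 + K) * P m \<le> H m" unfolding H_def using Q P1[of m] by (intro mult_right_mono) auto
    thus ?thesis using K[of m] P1[of m] by (simp add: algebra_simps)
  qed
  have sN: "strict_mono N" by (rule strict_monoI) (simp add: N_def)
  have NH: "real (N (Suc m)) \<le> exp (H m)" for m
  proof -
    have "real (Suc m) * ln 2 \<le> real (Suc m) * 1"
      using ln_2_less_1 by (intro mult_left_mono) auto
    also have "\<dots> \<le> H m" using HK[of m] by simp
    finally have "real (Suc m) * ln 2 \<le> H m" .
    hence "exp (ln (real (N (Suc m)))) \<le> exp (H m)" by (simp only: lnN exp_le_cancel_iff)
    thus ?thesis by (simp add: N_def)
  qed
  have BH: "(2 powr (real k powr \<gamma>) * real k ^ 2) powr (1 / \<beta>) \<le> exp (H m)" if k: "k < N (Suc m)" for m k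
  proof (cases "k = 0")
    case False
    have "ln (real k) \<le> ln (real (N (Suc m)))" using k False by simp
    also have "\<dots> \<le> real (Suc m)" unfolding lnN using ln_2_less_1 by (intro mult_left_le) auto
    also have "\<dots> \<le> K * P m" by (rule K)
    finally have lk: "ln (real k) \<le> K * P m" .
    have "real k powr \<gamma> \<le> real (N (Suc m)) powr \<gamma>" using k pos by (intro powr_mono2) auto
    also have "real (N (Suc m)) = 2 powr real (Suc m)"
      unfolding N_def by (subst powr_realpow) simp_all
    also have "(2 powr real (Suc m)) powr \<gamma> = 2 powr \<gamma> * P m"
      unfolding powr_powr by (simp add: P_def algebra_simps flip: powr_add)
    also have "\<dots> \<le> 2 * P m"
      using powr_mono[of \<gamma> 1 2] pos P1[of m] by (intro mult_right_mono) auto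
    finally have kg: "real k powr \<gamma> \<le> 2 * P m" .
    hence kg: "real k powr \<gamma> * ln 2 \<le> 2 * P m"
      using ln_2_less_1 by (intro order.trans[OF mult_left_le]) auto
    have "(2 powr (real k powr \<gamma>) * real k ^ 2) powr (1 / \<beta>) = exp ((real k powr \<gamma> * ln 2 + 2 * ln (real k)) / \<beta>)"
      using False by (simp add: powr_def[of _ "1 / \<beta>"] ln_mult ln_realpow ln_powr)
    also have "(real k powr \<gamma> * ln 2 + 2 * ln (real k)) / \<beta> \<le> (2 * P m + 2 * (K * P m)) / \<beta>"
      using lk kg pos by (intro divide_right_mono add_mono) auto
    also have "\<dots> = ((2 + 2 * K) / \<beta>) * P m" by (simp add: algebra_simps add_divide_distrib)
    also have "\<dots> \<le> H m" unfolding H_def using Q P1[of m] by (intro mult_right_mono) auto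
    finally show ?thesis by simp
  qed simp
  have "summable (\<lambda>m. sqrt (R (N m) * H m))"
  \<comment> \<open>\<open>c\<close> is decreasing, so \<open>q m\<close> is its reciprocal at the
    left end of the block; \<open>\<kappa>\<close> again gives equality.\<close>
  proof (rule summable_condensed[OF _ _ R _ sm, where q = "\<lambda>m. real (N m) powr (\<gamma> / 2)" and \<kappa> = "ln 2 / (sqrt Q * 2 powr (\<gamma> / 2))"])
    show "N m \<le> N (Suc m)" for m using sN by (simp add: strict_mono_less_eq)
    show "1 \<le> N 0" by (simp add: N_def)
    show "0 < c n" if "n \<ge> 1" for n using c[OF that] that by simp
    show "real (N m) powr (\<gamma> / 2) * c n \<le> 1" if n: "N m \<le> n" "n < N (Suc m)" for m n
    proof -
      have N0: "N m \<ge> 1" by (simp add: N_def)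
      hence n1: "n \<ge> 1" using n by simp
      have "c n \<le> real (N m) powr (- \<gamma> / 2)" unfolding c[OF n1]
        using n N0 pos by (intro powr_mono2') auto
      hence "real (N m) powr (\<gamma> / 2) * c n \<le> real (N m) powr (\<gamma> / 2) * real (N m) powr (- \<gamma> / 2)"
        by (intro mult_left_mono) auto
      also have "\<dots> = 1" using N0 by (simp flip: powr_add)
      finally show ?thesis .
    qed
    show "ln 2 / (sqrt Q * 2 powr (\<gamma> / 2)) * sqrt (H (Suc m))
        \<le> real (N m) powr (\<gamma> / 2) * ln (real (N (Suc m)) / real (N m))" for m
    proof -
      have "sqrt (P (Suc m)) = 2 powr (\<gamma> / 2) * real (N m) powr (\<gamma> / 2)"
        by (simp add: P_def N_def powr_powr algebra_simps add_divide_distrib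
            flip: powr_half_sqrt powr_realpow powr_add)
      moreover have "ln (real (N (Suc m)) / real (N m)) = ln 2" by (simp add: N_def)
      ultimately show ?thesis using Q(3) by (simp add: H_def real_sqrt_mult)
    qed
    show "H m \<ge> 0" for m using HK[of m] by simp
  qed (use Q in auto)
  moreover have "H m \<ge> 1" "H m \<ge> real m" for m using HK[of m] by simp_all
  ultimately show ?thesis using sN NH BH by blast
qed

subsection \<open>Deterministic estimates\<close>

lemma B_space_has_sum:
  assumes "f \<in> B_space"
  shows "((\<lambda>j. fourier_coeff f j * circ (of_int j * x)) has_sum f x) UNIV"
proof -
  have eq: "circ (of_int j * x) = exp (2 * \<i> * of_real pi * of_real x * of_int j)" for j
    unfolding circ_eq_exp by (simp add: mult_ac)
  show ?thesis using assms unfolding eq B_space_def by blast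
qed

lemma B_space_abs_summable:
  assumes "f \<in> B_space"
  shows "(\<lambda>j. cmod (fourier_coeff f j)) summable_on UNIV"
proof (rule summable_on_comparison_test)
  show "(\<lambda>j. cmod (fourier_coeff f j) * sqrt (ln (real_of_int \<bar>j\<bar> + 3))) summable_on UNIV"
    using assms by (simp add: B_space_def)
  show "cmod (fourier_coeff f j) \<le> cmod (fourier_coeff f j) * sqrt (ln (real_of_int \<bar>j\<bar> + 3))" for j
    using one_le_ln_add_3[of "real_of_int \<bar>j\<bar>"] by (simp add: mult_le_cancel_left1)
qed simp

text \<open>The Fourier series converges uniformly by the Weierstrass test. Continuity of
  \<open>f\<close> is what makes the partial sums of the random series continuous in
  \<open>\<alpha>\<close>.\<close>

lemma B_space_continuous:
  assumes "f \<in> B_space"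
  shows "continuous_on A f"
proof -
  have "uniform_limit UNIV (\<lambda>X x. \<Sum>j\<in>X. fourier_coeff f j * circ (of_int j * x)) f (finite_subsets_at_top UNIV)"
    by (rule Weierstrass_m_test_general'[OF _ B_space_has_sum[OF assms] B_space_abs_summable[OF assms]])
       (simp add: norm_mult)
  hence "continuous_on UNIV f"
    by (rule uniform_limit_theorem[rotated])
       (auto intro!: always_eventually continuous_intros)
  thus ?thesis by (rule continuous_on_subset) simp
qed

lemma has_sum_sum_index:
  fixes f :: "'i \<Rightarrow> 'j \<Rightarrow> 'b::topological_comm_monoid_add"
  assumes "\<And>i. i \<in> I \<Longrightarrow> (f i has_sum s i) A"
  shows "((\<lambda>j. \<Sum>i\<in>I. f i j) has_sum (\<Sum>i\<in>I. s i)) A"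
  using assms by (induction I rule: infinite_finite_induct) (auto intro: has_sum_add)

lemma fourier_coeff_0: "fourier_coeff f 0 = integral {0..1} f"
  by (simp add: fourier_coeff_def)

text \<open>Expanding \<open>f\<close> in its Fourier series exchanges a finite sum over
  \<open>k\<close> with the sum over \<open>j\<close>. The growth allowed in \<open>j\<close> is
  exactly the weight in the norm of \<open>B_space\<close>, so the sum over \<open>j\<close> is at
  most the norm \<open>W\<close> times a small factor.\<close>

lemma uniformly_Cauchy_on_exponential_sums:
  fixes a :: "nat \<Rightarrow> complex" and x :: "nat \<Rightarrow> real"
  assumes f: "f \<in> B_space" "integral {0..1} f = 0"
    and bound: "\<And>e. e > 0 \<Longrightarrow> \<exists>n0. \<forall>n\<ge>n0. \<forall>p\<ge>n. \<forall>\<alpha>\<in>K. \<forall>j::int. j \<noteq> 0 \<longrightarrow>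
      norm (\<Sum>k\<in>{n..<p}. a k * circ (of_int j * \<alpha> * x k)) \<le> e * sqrt (ln (real_of_int \<bar>j\<bar> + 3))"
  shows "uniformly_Cauchy_on K (\<lambda>n \<alpha>. \<Sum>k<n. a k * f (\<alpha> * x k))"
proof (rule uniformly_Cauchy_onI')
  let ?w = "\<lambda>j. cmod (fourier_coeff f j) * sqrt (ln (real_of_int \<bar>j\<bar> + 3))"
  define W where "W = infsum ?w UNIV"
  have w: "(?w has_sum W) UNIV"
    unfolding W_def using f(1) by (intro has_sum_infsum) (simp add: B_space_def)
  have W0: "W \<ge> 0"
    unfolding W_def by (intro infsum_nonneg mult_nonneg_nonneg) simp_all
  fix e :: real assume e: "e > 0"
  \<comment> \<open>\<open>W + 1\<close> avoids division by zero and makes the final inequality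
    strict.\<close>
  have "e / (W + 1) > 0" using e W0 by simp
  from bound[OF this] obtain n0 where n0: "\<forall>n\<ge>n0. \<forall>p\<ge>n. \<forall>\<alpha>\<in>K. \<forall>j::int. j \<noteq> 0 \<longrightarrow>
      norm (\<Sum>k\<in>{n..<p}. a k * circ (of_int j * \<alpha> * x k)) \<le> e / (W + 1) * sqrt (ln (real_of_int \<bar>j\<bar> + 3))"
    by (rule exE)
  have "dist (\<Sum>k<n. a k * f (\<alpha> * x k)) (\<Sum>k<p. a k * f (\<alpha> * x k)) < e"
    if \<alpha>: "\<alpha> \<in> K" and n: "n \<ge> n0" "p > n" for \<alpha> n p
  proof -
    have "(\<Sum>k<p. a k * f (\<alpha> * x k)) = (\<Sum>k<n. a k * f (\<alpha> * x k)) + (\<Sum>k\<in>{n..<p}. a k * f (\<alpha> * x k))"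
      using n(2) by (subst sum.union_disjoint[symmetric]) (auto intro: sum.cong)
    hence "dist (\<Sum>k<n. a k * f (\<alpha> * x k)) (\<Sum>k<p. a k * f (\<alpha> * x k))
            = norm (\<Sum>k\<in>{n..<p}. a k * f (\<alpha> * x k))"
      by (simp add: dist_norm norm_minus_commute)
    also have "\<dots> \<le> e / (W + 1) * W"
    proof (rule norm_infsum_le)
      have "((\<lambda>j. \<Sum>k\<in>{n..<p}. a k * (fourier_coeff f j * circ (of_int j * (\<alpha> * x k))))
              has_sum (\<Sum>k\<in>{n..<p}. a k * f (\<alpha> * x k))) UNIV"
        by (intro has_sum_sum_index has_sum_cmult_right B_space_has_sum f)
      also have "(\<lambda>j. \<Sum>k\<in>{n..<p}. a k * (fourier_coeff f j * circ (of_int j * (\<alpha> * x k))))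
          = (\<lambda>j. fourier_coeff f j * (\<Sum>k\<in>{n..<p}. a k * circ (of_int j * \<alpha> * x k)))"
        by (simp add: sum_distrib_left mult_ac)
      finally show "((\<lambda>j. fourier_coeff f j * (\<Sum>k\<in>{n..<p}. a k * circ (of_int j * \<alpha> * x k)))
          has_sum (\<Sum>k\<in>{n..<p}. a k * f (\<alpha> * x k))) UNIV" .
      show "((\<lambda>j. e / (W + 1) * ?w j) has_sum (e / (W + 1) * W)) UNIV"
        by (intro has_sum_cmult_right w)
      show "norm (fourier_coeff f j * (\<Sum>k\<in>{n..<p}. a k * circ (of_int j * \<alpha> * x k))) \<le> e / (W + 1) * ?w j" for j
      \<comment> \<open>At frequency 0 the exponential sum is a plain sum of the \<open>a k\<close>,
        for which \<open>bound\<close> says nothing; the vanishing mean of \<open>f\<close> removes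
        this term.\<close>
      proof (cases "j = 0")
        case True
        thus ?thesis using f(2) by (simp add: fourier_coeff_0)
      next
        case False
        have "norm (fourier_coeff f j * (\<Sum>k\<in>{n..<p}. a k * circ (of_int j * \<alpha> * x k)))
           \<le> cmod (fourier_coeff f j) * (e / (W + 1) * sqrt (ln (real_of_int \<bar>j\<bar> + 3)))"
          unfolding norm_mult by (intro mult_left_mono n0[rule_format]) (use n \<alpha> False in auto)
        thus ?thesis by (simp add: mult_ac)
      qed
    qed
    also have "\<dots> < e" using e W0 by (simp add: field_simps)
    finally show ?thesis .
  qed
  thus "\<exists>M. \<forall>\<alpha>\<in>K. \<forall>n\<ge>M. \<forall>p>n. dist (\<Sum>k<n. a k * f (\<alpha> * x k)) (\<Sum>k<p. a k * f (\<alpha> * x k)) < e"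
    by blast
qed

text \<open>A range starting at some \<open>N M\<close> consists of whole blocks and an initial
  segment of one more, so the \<open>T m\<close> add up to a small tail. A general range is a
  difference of two such ranges, each contributing \<open>e / 2\<close>. The factor
  \<open>L t\<close> comes out of every bound, so \<open>n0\<close> does not depend on
  \<open>t\<close>.\<close>

lemma tail_bound_from_blocks:
  fixes y :: "nat \<Rightarrow> 'i \<Rightarrow> complex" and N :: "nat \<Rightarrow> nat" and T :: "nat \<Rightarrow> real" and L :: "'i \<Rightarrow> real"
  assumes N: "strict_mono N" and T: "summable T" "\<And>m. T m \<ge> 0" and L: "\<And>t. L t \<ge> 0"
    and block: "\<And>m p t. m \<ge> m0 \<Longrightarrow> p \<le> N (Suc m) \<Longrightarrow> norm (\<Sum>k\<in>{N m..<p}. y k t) \<le> T m * L t"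
    and "e > 0"
  shows "\<exists>n0. \<forall>n\<ge>n0. \<forall>p\<ge>n. \<forall>t. norm (\<Sum>k\<in>{n..<p}. y k t) \<le> e * L t"
proof -
  have "e / 2 > 0" using \<open>e > 0\<close> by simp
  with T(1) obtain M1 where M1: "\<And>m n. m \<ge> M1 \<Longrightarrow> norm (sum T {m..<n}) < e / 2"
    unfolding summable_Cauchy by blast
  define M where "M = max M1 m0"
  have step: "\<forall>p. N M \<le> p \<and> p \<le> N M' \<longrightarrow> norm (\<Sum>k\<in>{N M..<p}. y k t) \<le> sum T {M..<M'} * L t"
    if "M' \<ge> M" for M' t
    using that
  proof (induction rule: dec_induct)
    case base
    show ?case by auto
  next
    case (step M')
    show ?case
    proof (intro allI impI)
      fix p assume p: "N M \<le> p \<and> p \<le> N (Suc M')"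
      have s: "sum T {M..<Suc M'} = sum T {M..<M'} + T M'" using step by simp
      show "norm (\<Sum>k\<in>{N M..<p}. y k t) \<le> sum T {M..<Suc M'} * L t"
      proof (cases "p \<le> N M'")
        case True
        hence "norm (\<Sum>k\<in>{N M..<p}. y k t) \<le> sum T {M..<M'} * L t" using step p by blast
        also have "\<dots> \<le> sum T {M..<Suc M'} * L t" using T(2) L s by (intro mult_right_mono) auto
        finally show ?thesis .
      next
        case False
        have NM: "N M \<le> N M'" using N step by (simp add: strict_mono_less_eq)
        have "(\<Sum>k\<in>{N M..<p}. y k t) = (\<Sum>k\<in>{N M..<N M'}. y k t) + (\<Sum>k\<in>{N M'..<p}. y k t)"
          using NM False by (simp add: sum.atLeastLessThan_concat)
        also have "norm \<dots> \<le> sum T {M..<M'} * L t + T M' * L t"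
        proof (rule norm_triangle_mono)
          show "norm (\<Sum>k\<in>{N M..<N M'}. y k t) \<le> sum T {M..<M'} * L t" using step NM by blast
          show "norm (\<Sum>k\<in>{N M'..<p}. y k t) \<le> T M' * L t"
            using block[of M' p t] p step by (simp add: M_def)
        qed
        finally show ?thesis by (simp only: s distrib_right)
      qed
    qed
  qed
  have tail: "norm (\<Sum>k\<in>{N M..<p}. y k t) \<le> e / 2 * L t" if "p \<ge> N M" for p t
  proof -
    \<comment> \<open>Strict monotonicity gives \<open>i \<le> N i\<close>, so finitely many blocks
      reach \<open>p\<close>.\<close>
    have "p \<le> N (max M p)" using seq_suble[OF N, of "max M p"] by linarith
    hence "norm (\<Sum>k\<in>{N M..<p}. y k t) \<le> sum T {M..<max M p} * L t" using step[of "max M p" t] that by simp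
    also have "\<dots> \<le> e / 2 * L t"
      using M1[of M "max M p"] L by (intro mult_right_mono) (auto simp: M_def)
    finally show ?thesis .
  qed
  have "norm (\<Sum>k\<in>{n..<p}. y k t) \<le> e * L t" if n: "n \<ge> N M" "p \<ge> n" for n p t
  proof -
    have "(\<Sum>k\<in>{n..<p}. y k t) = (\<Sum>k\<in>{N M..<p}. y k t) - (\<Sum>k\<in>{N M..<n}. y k t)"
      using n sum.atLeastLessThan_concat[of "N M" n p "\<lambda>k. y k t"] by (simp add: algebra_simps)
    also have "norm \<dots> \<le> e / 2 * L t + e / 2 * L t"
      by (rule order.trans[OF norm_triangle_ineq4]) (use n in \<open>intro add_mono tail; simp\<close>)
    finally show ?thesis by simp
  qed
  thus ?thesis by blast
qed

lemma norm_sum_mult_le_sqrt: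
  fixes a b :: "'i \<Rightarrow> complex"
  shows "norm (\<Sum>i\<in>I. a i * b i) \<le> sqrt (\<Sum>i\<in>I. (norm (a i))\<^sup>2) * sqrt (\<Sum>i\<in>I. (norm (b i))\<^sup>2)"
proof -
  have "norm (\<Sum>i\<in>I. a i * b i) \<le> (\<Sum>i\<in>I. norm (a i) * norm (b i))"
    by (rule order.trans[OF norm_sum]) (simp add: norm_mult)
  also have "\<dots> \<le> sqrt ((\<Sum>i\<in>I. (norm (a i))\<^sup>2) * (\<Sum>i\<in>I. (norm (b i))\<^sup>2))"
    by (rule real_le_rsqrt) (rule Cauchy_Schwarz_ineq_sum)
  finally show ?thesis by (simp add: real_sqrt_mult)
qed

text \<open>The logarithm of \<open>(A + 1) * (\<bar>j\<bar> + 3)\<close> is a sum, and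
  \<open>ln (\<bar>j\<bar> + 3) \<ge> 1\<close> absorbs \<open>ln (A + 1)\<close> into a factor. The
  weight at frequency \<open>j * \<alpha>\<close> becomes the weight at \<open>j\<close>, uniformly
  for \<open>\<alpha>\<close> in a bounded set.\<close>

lemma sqrt_ln_abs_mult_le:
  assumes "\<bar>\<alpha>\<bar> \<le> A"
  shows "sqrt (ln (\<bar>of_int j * \<alpha>\<bar> + 3)) \<le> sqrt (ln (A + 1) + 1) * sqrt (ln (real_of_int \<bar>j\<bar> + 3))"
proof -
  have A: "A \<ge> 0" using assms by simp
  let ?l = "ln (real_of_int \<bar>j\<bar> + 3)"
  have "\<bar>of_int j * \<alpha>\<bar> + 3 \<le> real_of_int \<bar>j\<bar> * A + 3"
    using assms by (simp add: abs_mult mult_left_mono)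
  also have "\<dots> \<le> (A + 1) * (real_of_int \<bar>j\<bar> + 3)" using A by (simp add: algebra_simps)
  finally have "ln (\<bar>of_int j * \<alpha>\<bar> + 3) \<le> ln ((A + 1) * (real_of_int \<bar>j\<bar> + 3))" by (intro ln_mono) auto
  also have "\<dots> = ln (A + 1) + ?l" using A by (subst ln_mult) auto
  also have "\<dots> \<le> ln (A + 1) * ?l + ?l"
    using A one_le_ln_add_3[of "real_of_int \<bar>j\<bar>"] by (simp add: mult_le_cancel_left1)
  finally have "sqrt (ln (\<bar>of_int j * \<alpha>\<bar> + 3)) \<le> sqrt ((ln (A + 1) + 1) * ?l)"
    by (simp add: algebra_simps)
  thus ?thesis by (simp add: real_sqrt_mult)
qed

subsection \<open>Almost sure uniform convergence\<close>

context prob_space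
begin

text \<open>Two almost sure events suffice: \<open>X k\<close> agrees with its truncation
  \<open>Y k\<close> for large \<open>k\<close>, and the block bounds hold for all real
  \<open>t\<close>. Both are fixed before \<open>f\<close> and \<open>K\<close>, so the exceptional
  set depends on neither.\<close>

lemma AE_uniformly_Cauchy_random_series:
  fixes X :: "nat \<Rightarrow> 'a \<Rightarrow> real" and a :: "nat \<Rightarrow> complex" and N :: "nat \<Rightarrow> nat" and H R B :: "nat \<Rightarrow> real"
  assumes indep: "indep_vars (\<lambda>_. borel) X UNIV" and N: "strict_mono N"
    and H: "\<And>m. H m \<ge> 1" "\<And>m. H m \<ge> real m" and NH: "\<And>m. real (N (Suc m)) \<le> exp (H m)"
    and BH: "\<And>m k. k < N (Suc m) \<Longrightarrow> B k \<le> exp (H m)"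
    and sB: "summable (\<lambda>k. prob {\<omega>\<in>space M. B k < \<bar>X k \<omega>\<bar>})"
    and R: "\<And>m p. (\<Sum>k\<in>{N m..<p}. (norm (a k))\<^sup>2) \<le> R m"
    and sR: "summable (\<lambda>m. sqrt (R m * H m))"
    and \<phi>: "\<And>K. compact K \<Longrightarrow> 0 \<notin> K \<Longrightarrow> \<exists>n0. \<forall>n\<ge>n0. \<forall>p. \<forall>\<alpha>\<in>K. \<forall>j::int. j \<noteq> 0 \<longrightarrow>
              (\<Sum>k\<in>{n..<p}. (norm (char_fun M (X k) (of_int j * \<alpha>)))\<^sup>2) \<le> 1"
  shows "AE \<omega> in M. \<forall>f\<in>B_space. integral {0..1} f = 0 \<longrightarrow> (\<forall>K. compact K \<and> 0 \<notin> K \<longrightarrow>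
           uniformly_Cauchy_on K (\<lambda>n \<alpha>. \<Sum>k<n. a k * f (\<alpha> * X k \<omega>)))"
proof -
  have [measurable]: "random_variable borel (X k)" for k
    using indep by (simp add: indep_vars_def2)
  \<comment> \<open>Truncation at \<open>B k\<close> makes the characteristic functions Lipschitz, which low-order moments do not give.\<close>
  define Y where "Y = (\<lambda>k \<omega>. if \<bar>X k \<omega>\<bar> \<le> B k then X k \<omega> else 0)"
  have indY: "indep_vars (\<lambda>_. borel) Y UNIV"
    unfolding Y_def by (rule indep_vars_compose2[OF indep]) measurable
  have [measurable]: "random_variable borel (Y k)" for k
    using indY by (simp add: indep_vars_def2)
  have YH: "\<bar>Y k \<omega>\<bar> \<le> exp (H m)" if "k < N (Suc m)" for m k \<omega>
    using BH[OF that] by (auto simp: Y_def)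
  have R0: "R m \<ge> 0" for m using R[of m 0] by simp
  have sumH: "summable (\<lambda>m. exp (- H m))"
  proof (rule summable_comparison_test')
    show "summable (\<lambda>m. exp (-1) ^ m :: real)" by (rule summable_geometric) simp
    show "norm (exp (- H m)) \<le> exp (-1) ^ m" for m
      using H(2)[of m] by (simp flip: exp_of_nat_mult)
  qed
  define q where "q k = prob {\<omega>\<in>space M. X k \<omega> \<noteq> Y k \<omega>}" for k
  have q0: "q k \<ge> 0" "q k \<le> 1" for k by (simp_all add: q_def)
  have "norm (q k) \<le> prob {\<omega>\<in>space M. B k < \<bar>X k \<omega>\<bar>}" for k
    unfolding q_def by (auto simp: Y_def intro!: finite_measure_mono)
  hence sq: "summable q" by (intro summable_comparison_test'[OF sB])
  have "AE \<omega> in M. eventually (\<lambda>k. \<omega> \<in> space M - {\<omega>\<in>space M. X k \<omega> \<noteq> Y k \<omega>}) sequentially"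
    by (rule borel_cantelli_AE1) (use sq in \<open>auto simp: q_def[abs_def] less_top[symmetric]\<close>)
  moreover have "AE \<omega> in M. \<exists>m0. \<forall>m\<ge>m0. \<forall>p\<le>N (Suc m). \<forall>t.
           norm (\<Sum>k\<in>{N m..<p}. a k * (circ (t * Y k \<omega>) - char_fun M (Y k) t))
             \<le> 25 * sqrt (R m * H m) * sqrt (ln (\<bar>t\<bar> + 3))"
    by (rule AE_block_bound[OF indY H(1) sumH NH YH R])
  ultimately show ?thesis
  proof eventually_elim
    case (elim \<omega>)
    then obtain k0 where k0: "\<And>k. k \<ge> k0 \<Longrightarrow> X k \<omega> = Y k \<omega>"
      by (auto simp: eventually_sequentially)
    from elim(2) obtain m0 where m0: "\<And>m p t. m \<ge> m0 \<Longrightarrow> p \<le> N (Suc m) \<Longrightarrow>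
        norm (\<Sum>k\<in>{N m..<p}. a k * (circ (t * Y k \<omega>) - char_fun M (Y k) t))
             \<le> 25 * sqrt (R m * H m) * sqrt (ln (\<bar>t\<bar> + 3))"
      by blast
    show ?case
    proof (intro ballI impI allI, elim conjE, rule uniformly_Cauchy_on_exponential_sums)
      fix K :: "real set" and e :: real
      assume K: "compact K" "0 \<notin> K" and e: "e > 0"
      obtain A where A: "A > 0" "\<And>\<alpha>. \<alpha> \<in> K \<Longrightarrow> \<bar>\<alpha>\<bar> \<le> A"
        using compact_imp_bounded[OF K(1)] by (auto simp: bounded_pos)
      define C where "C = sqrt (ln (A + 1) + 1)"
      have C: "C > 0" using A(1) by (simp add: C_def add_nonneg_pos)
      obtain n1 where n1: "\<forall>n\<ge>n1. \<forall>p. \<forall>\<alpha>\<in>K. \<forall>j::int. j \<noteq> 0 \<longrightarrow>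
              (\<Sum>k\<in>{n..<p}. (norm (char_fun M (X k) (of_int j * \<alpha>)))\<^sup>2) \<le> 1"
        using \<phi>[OF K] by (rule exE)
      \<comment> \<open>From \<open>(x + 2 * q)^2 \<le> 2 * x^2 + 8 * q^2\<close> and
        \<open>q^2 \<le> q\<close>, with the squares for \<open>X\<close> summing to at most
        1.\<close>
      define V where "V = 2 + 8 * suminf q"
      have V: "V > 0" using suminf_nonneg[OF sq q0(1)] by (simp add: V_def)
      have charY: "(\<Sum>k\<in>{n..<p}. (norm (char_fun M (Y k) (of_int j * \<alpha>)))\<^sup>2) \<le> V"
        if "n \<ge> n1" "\<alpha> \<in> K" "j \<noteq> 0" for n p \<alpha> and j :: int
      proof -
        let ?t = "of_int j * \<alpha>"
        have "(norm (char_fun M (Y k) ?t))\<^sup>2 \<le> 2 * (norm (char_fun M (X k) ?t))\<^sup>2 + 8 * q k" for k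
        proof -
          let ?x = "norm (char_fun M (X k) ?t)"
          have "norm (char_fun M (Y k) ?t) \<le> ?x + norm (char_fun M (X k) ?t - char_fun M (Y k) ?t)"
            by (metis norm_minus_commute norm_triangle_sub)
          also have "\<dots> \<le> ?x + 2 * q k"
            unfolding q_def by (intro add_left_mono norm_char_fun_diff_le_prob) auto
          finally have "(norm (char_fun M (Y k) ?t))\<^sup>2 \<le> (?x + 2 * q k)\<^sup>2" by (rule power_mono) simp
          also have "\<dots> \<le> 2 * ?x\<^sup>2 + 8 * (q k)\<^sup>2"
            using zero_le_power2[of "?x - 2 * q k"] by (simp add: power2_eq_square algebra_simps)
          also have "(q k)\<^sup>2 \<le> q k" using q0[of k] by (simp add: power2_eq_square mult_left_le)
          finally show ?thesis by simp
        qed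
        hence "(\<Sum>k\<in>{n..<p}. (norm (char_fun M (Y k) ?t))\<^sup>2)
            \<le> (\<Sum>k\<in>{n..<p}. 2 * (norm (char_fun M (X k) ?t))\<^sup>2 + 8 * q k)"
          by (rule sum_mono)
        also have "\<dots> = 2 * (\<Sum>k\<in>{n..<p}. (norm (char_fun M (X k) ?t))\<^sup>2) + 8 * sum q {n..<p}"
          by (simp add: sum.distrib sum_distrib_left)
        also have "\<dots> \<le> 2 * 1 + 8 * suminf q"
        proof (intro add_mono mult_left_mono)
          show "(\<Sum>k\<in>{n..<p}. (norm (char_fun M (X k) ?t))\<^sup>2) \<le> 1"
            by (rule n1[rule_format]) (use that in auto)
          show "sum q {n..<p} \<le> suminf q" by (rule sum_le_suminf[OF sq]) (use q0 in auto)
        qed auto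
        finally show ?thesis by (simp add: V_def)
      qed
      \<comment> \<open>The centred sums receive \<open>e / 2\<close>; the extra \<open>C\<close>
        compensates for replacing the weight at \<open>j * \<alpha>\<close> by the weight at
        \<open>j\<close>.\<close>
      have "\<exists>n2. \<forall>n\<ge>n2. \<forall>p\<ge>n. \<forall>t. norm (\<Sum>k\<in>{n..<p}. a k * (circ (t * Y k \<omega>) - char_fun M (Y k) t))
              \<le> e / (2 * C) * sqrt (ln (\<bar>t\<bar> + 3))"
      proof (rule tail_bound_from_blocks[OF N])
        show "summable (\<lambda>m. 25 * sqrt (R m * H m))" by (intro summable_mult sR)
        show "0 \<le> 25 * sqrt (R m * H m)" for m using R0[of m] H(1)[of m] by simp
        show "0 \<le> sqrt (ln (\<bar>t\<bar> + 3))" for t :: real by simp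
      qed (use m0 e C in auto)
      then obtain n2 where n2: "\<And>n p t. n \<ge> n2 \<Longrightarrow> p \<ge> n \<Longrightarrow>
            norm (\<Sum>k\<in>{n..<p}. a k * (circ (t * Y k \<omega>) - char_fun M (Y k) t))
              \<le> e / (2 * C) * sqrt (ln (\<bar>t\<bar> + 3))"
        by blast
      \<comment> \<open>The means receive the other \<open>e / 2\<close>. The terms of a convergent
        series tend to 0, and \<open>H m1 \<ge> 1\<close> passes the smallness on to
        \<open>sqrt (R m1)\<close>, the factor that Cauchy--Schwarz pairs with
        \<open>sqrt V\<close>.\<close>
      have "e / (2 * sqrt V) > 0" using e V by simp
      from eventually_happens'[OF sequentially_bot order_tendstoD(2)[OF summable_LIMSEQ_zero[OF sR] this]]
      obtain m1 where m1: "sqrt (R m1 * H m1) < e / (2 * sqrt V)" by blast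
      have "sqrt (R m1) \<le> sqrt (R m1 * H m1)"
        using R0[of m1] H(1)[of m1] by (simp add: mult_le_cancel_left1)
      hence "sqrt (R m1) \<le> e / (2 * sqrt V)" using m1 by linarith
      hence RV: "sqrt (R m1) * sqrt V \<le> e / 2" using V by (simp add: field_simps)
      have "norm (\<Sum>k\<in>{n..<p}. a k * circ (of_int j * \<alpha> * X k \<omega>)) \<le> e * sqrt (ln (real_of_int \<bar>j\<bar> + 3))"
        if n: "n \<ge> max (max k0 (N m1)) (max n1 n2)" "p \<ge> n" and \<alpha>: "\<alpha> \<in> K" and j: "j \<noteq> 0"
        for n p \<alpha> and j :: int
      proof -
        let ?t = "of_int j * \<alpha>" and ?l = "sqrt (ln (real_of_int \<bar>j\<bar> + 3))"
        have l: "?l \<ge> 1" using one_le_ln_add_3[of "real_of_int \<bar>j\<bar>"] by simp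
        have "(\<Sum>k\<in>{n..<p}. a k * circ (?t * X k \<omega>)) = (\<Sum>k\<in>{n..<p}. a k * circ (?t * Y k \<omega>))"
          using n k0 by (intro sum.cong) auto
        also have "\<dots> = (\<Sum>k\<in>{n..<p}. a k * (circ (?t * Y k \<omega>) - char_fun M (Y k) ?t))
            + (\<Sum>k\<in>{n..<p}. a k * char_fun M (Y k) ?t)"
          by (simp add: algebra_simps flip: sum.distrib)
        also have "norm \<dots> \<le> e / 2 * ?l + e / 2 * ?l"
        proof (rule norm_triangle_mono)
          have "norm (\<Sum>k\<in>{n..<p}. a k * (circ (?t * Y k \<omega>) - char_fun M (Y k) ?t))
              \<le> e / (2 * C) * sqrt (ln (\<bar>?t\<bar> + 3))"
            by (rule n2) (use n in auto)
          also have "\<dots> \<le> e / (2 * C) * (C * ?l)"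
            unfolding C_def using sqrt_ln_abs_mult_le[OF A(2)[OF \<alpha>], of j] e C
            by (intro mult_left_mono) (auto simp: C_def)
          also have "\<dots> = e / 2 * ?l" using C by simp
          finally show "norm (\<Sum>k\<in>{n..<p}. a k * (circ (?t * Y k \<omega>) - char_fun M (Y k) ?t)) \<le> e / 2 * ?l" .
          have "norm (\<Sum>k\<in>{n..<p}. a k * char_fun M (Y k) ?t)
              \<le> sqrt (\<Sum>k\<in>{n..<p}. (norm (a k))\<^sup>2) * sqrt (\<Sum>k\<in>{n..<p}. (norm (char_fun M (Y k) ?t))\<^sup>2)"
            by (rule norm_sum_mult_le_sqrt)
          also have "\<dots> \<le> sqrt (R m1) * sqrt V"
          proof (intro mult_mono real_sqrt_le_mono)
            have "(\<Sum>k\<in>{n..<p}. (norm (a k))\<^sup>2) \<le> (\<Sum>k\<in>{N m1..<p}. (norm (a k))\<^sup>2)"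
              using n by (intro sum_mono2) auto
            also note R
            finally show "(\<Sum>k\<in>{n..<p}. (norm (a k))\<^sup>2) \<le> R m1" .
            show "(\<Sum>k\<in>{n..<p}. (norm (char_fun M (Y k) ?t))\<^sup>2) \<le> V"
              by (rule charY) (use n \<alpha> j in auto)
          qed (use R0 in \<open>auto intro: sum_nonneg\<close>)
          also have "\<dots> \<le> e / 2 * 1" using RV by simp
          also have "\<dots> \<le> e / 2 * ?l" using e l by (intro mult_left_mono) auto
          finally show "norm (\<Sum>k\<in>{n..<p}. a k * char_fun M (Y k) ?t) \<le> e / 2 * ?l" .
        qed
        finally show ?thesis by simp
      qed
      thus "\<exists>n0. \<forall>n\<ge>n0. \<forall>p\<ge>n. \<forall>\<alpha>\<in>K. \<forall>j::int. j \<noteq> 0 \<longrightarrow>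
          norm (\<Sum>k\<in>{n..<p}. a k * circ (of_int j * \<alpha> * X k \<omega>)) \<le> e * sqrt (ln (real_of_int \<bar>j\<bar> + 3))"
        by blast
    qed
  qed
qed

end

section \<open>From uniform Cauchy estimates to the continuous limit, and the final assembly\<close>

lemma random_series_properties:
  assumes f: "f \<in> B_space"
    and Cauchy: "\<And>K. compact K \<Longrightarrow> 0 \<notin> K \<Longrightarrow> uniformly_Cauchy_on K (\<lambda>n \<alpha>. \<Sum>k<n. a k * f (\<alpha> * X k \<omega>))"
  shows "\<alpha> \<noteq> 0 \<Longrightarrow> summable (\<lambda>k. a k * f (\<alpha> * X k \<omega>))"
    and "continuous_on (UNIV - {0}) (\<lambda>\<alpha>. random_series a f X \<alpha> \<omega>)"
    and "compact K \<Longrightarrow> 0 \<notin> K \<Longrightarrow> uniform_limit K (\<lambda>n \<alpha>. \<Sum>k<n. a k * f (\<alpha> * X k \<omega>))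
           (\<lambda>\<alpha>. random_series a f X \<alpha> \<omega>) sequentially"
proof -
  show summable: "summable (\<lambda>k. a k * f (\<alpha> * X k \<omega>))" if "\<alpha> \<noteq> 0" for \<alpha>
    using uniformly_Cauchy_imp_Cauchy[OF Cauchy[of "{\<alpha>}"]] that
    by (simp add: summable_iff_convergent Cauchy_convergent_iff)
  show lim: "uniform_limit K (\<lambda>n \<alpha>. \<Sum>k<n. a k * f (\<alpha> * X k \<omega>))
      (\<lambda>\<alpha>. random_series a f X \<alpha> \<omega>) sequentially" if K: "compact K" "0 \<notin> K" for K
  proof -
    obtain l where l: "uniform_limit K (\<lambda>n \<alpha>. \<Sum>k<n. a k * f (\<alpha> * X k \<omega>)) l sequentially"
      using Cauchy_uniformly_convergent[OF Cauchy[OF K]] by (auto simp: uniformly_convergent_on_def)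
    have "l \<alpha> = random_series a f X \<alpha> \<omega>" if "\<alpha> \<in> K" for \<alpha>
      unfolding random_series_def using tendsto_uniform_limitI[OF l that] 
      by (intro sums_unique) (simp add: sums_def)
    hence "uniform_limit K (\<lambda>n \<alpha>. \<Sum>k<n. a k * f (\<alpha> * X k \<omega>)) l sequentially \<longleftrightarrow> ?thesis"
      by (intro uniform_limit_cong') auto
    thus ?thesis using l by simp
  qed
  have f_cont: "continuous_on A f" for A by (rule B_space_continuous[OF f])
  show "continuous_on (UNIV - {0}) (\<lambda>\<alpha>. random_series a f X \<alpha> \<omega>)"
  proof (rule continuous_at_imp_continuous_on, rule ballI)
    fix \<alpha> :: real assume "\<alpha> \<in> UNIV - {0}"
    hence \<alpha>: "\<alpha> \<noteq> 0" by simp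
    \<comment> \<open>A compact neighbourhood of \<open>\<alpha>\<close> that avoids 0: the uniform
      limit is continuous on it, hence at its interior point \<open>\<alpha>\<close>.\<close>
    let ?K = "cball \<alpha> (\<bar>\<alpha>\<bar> / 2)"
    have "0 \<notin> ?K" using \<alpha> by (simp add: dist_real_def)
    hence "continuous_on ?K (\<lambda>\<alpha>. random_series a f X \<alpha> \<omega>)"
      by (intro uniform_limit_theorem[OF _ lim] always_eventually allI continuous_intros
          continuous_on_compose2[OF f_cont[of UNIV]]) auto
    thus "isCont (\<lambda>\<alpha>. random_series a f X \<alpha> \<omega>) \<alpha>"
      using \<alpha> by (intro continuous_on_interior[where S = ?K]) auto
  qed
qed

theorem corollary1p3:
  fixes M :: "'a measure"
    and X :: "nat \<Rightarrow> 'a \<Rightarrow> real"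
    and c :: "nat \<Rightarrow> real"
    and a :: "nat \<Rightarrow> complex"
  assumes "prob_space M"
    and "prob_space.indep_vars M (\<lambda>_. borel) X UNIV"
    and "(polynomial_case M X \<and> (\<forall>n\<ge>1. c n = 1 + sqrt (ln (real n)))) \<or>
         (\<exists>\<gamma>. subexponential_case M X \<gamma> \<and> (\<forall>n\<ge>1. c n = real n powr (- \<gamma> / 2)))"
    and "\<And>K :: real set. compact K \<Longrightarrow> 0 \<notin> K \<Longrightarrow>
           \<forall>\<epsilon>>0. \<exists>N>0.
             (SUP (n, m) \<in> {(n, m). N \<le> n \<and> n < m}. SUP \<alpha>\<in>K. SUP j\<in>UNIV - {0::int}.
                ennreal (\<Sum>k=n..m. (cmod (char_fun M (X k) (of_int j * \<alpha>)))\<^sup>2)) < ennreal \<epsilon>"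
    and "(\<lambda>k. (cmod (a k))\<^sup>2) summable_on UNIV"
    and "(\<lambda>n. sqrt (\<Sum>\<^sub>\<infinity>k\<in>{n..}. (cmod (a k))\<^sup>2) / (real n * c n)) summable_on {1..}"
  shows "\<exists>\<Omega>\<^sub>0 \<in> sets M. measure M \<Omega>\<^sub>0 = 1 \<and>
           (\<forall>\<omega>\<in>\<Omega>\<^sub>0. \<forall>f\<in>B_space. integral {0..1} f = 0 \<longrightarrow>
              (\<forall>\<alpha>. \<alpha> \<noteq> 0 \<longrightarrow> summable (\<lambda>k. a k * f (\<alpha> * X k \<omega>))) \<and>
              continuous_on (UNIV - {0}) (\<lambda>\<alpha>. random_series a f X \<alpha> \<omega>) \<and>
              (\<forall>K. compact K \<and> 0 \<notin> K \<longrightarrow>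
                 uniform_limit K (\<lambda>n \<alpha>. \<Sum>k<n. a k * f (\<alpha> * X k \<omega>))
                   (\<lambda>\<alpha>. random_series a f X \<alpha> \<omega>) sequentially))"
proof -
  interpret prob_space M by fact
  note indep = assms(2) and sa = assms(5)
  have rv: "random_variable borel (X k)" for k
    using indep by (simp add: indep_vars_def2)
  define R where "R n = (\<Sum>\<^sub>\<infinity>k\<in>{n..}. (cmod (a k))\<^sup>2)" for n
  have sa': "(\<lambda>k. (cmod (a k))\<^sup>2) summable_on {n..}" for n :: nat
    by (rule summable_on_subset_banach[OF sa]) simp
  have R0: "R n \<ge> 0" for n unfolding R_def by (rule infsum_nonneg) simp
  have Rmono: "R n \<le> R m" if "m \<le> n" for m n
    unfolding R_def by (rule infsum_mono2[OF sa' sa']) (use that in auto)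
  have Rsum: "(\<Sum>k\<in>{n..<p}. (norm (a k))\<^sup>2) \<le> R n" for n p
    unfolding R_def by (rule finite_sum_le_infsum[OF sa']) auto
  have sR: "(\<lambda>n. sqrt (R n) / (real n * c n)) summable_on {1..}"
    unfolding R_def by fact
  have char: "\<exists>n0. \<forall>n\<ge>n0. \<forall>p. \<forall>\<alpha>\<in>K. \<forall>j::int. j \<noteq> 0 \<longrightarrow>
      (\<Sum>k\<in>{n..<p}. (norm (char_fun M (X k) (of_int j * \<alpha>)))\<^sup>2) \<le> 1"
    if K: "compact K" "0 \<notin> K" for K
  proof -
    let ?s = "\<lambda>n m \<alpha> j. \<Sum>k=n..m. (norm (char_fun M (X k) (of_int j * \<alpha>)))\<^sup>2"
    \<comment> \<open>The hypothesis is used with \<open>\<epsilon> = 1\<close>. The suprema are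
      taken in \<open>ennreal\<close>, a complete lattice, so each single sum lies below them
      without a boundedness check.\<close>
    obtain n0 where n0: "(SUP (n, m) \<in> {(n, m). n0 \<le> n \<and> n < m}. SUP \<alpha>\<in>K. SUP j\<in>UNIV - {0::int}.
                ennreal (?s n m \<alpha> j)) < ennreal 1"
      using assms(4)[OF K] zero_less_one by blast
    have "(\<Sum>k\<in>{n..<p}. (norm (char_fun M (X k) (of_int j * \<alpha>)))\<^sup>2) \<le> 1"
      if "n \<ge> n0" "\<alpha> \<in> K" "j \<noteq> 0" for n p \<alpha> and j :: int
    proof (cases "n < p")
      case True
      have "ennreal (?s n p \<alpha> j) \<le> (SUP j\<in>UNIV - {0::int}. ennreal (?s n p \<alpha> j))"
        by (rule SUP_upper) (use that in auto)
      also have "\<dots> \<le> (SUP \<alpha>\<in>K. SUP j\<in>UNIV - {0::int}. ennreal (?s n p \<alpha> j))"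
        by (rule SUP_upper) (use that in auto)
      also have "\<dots> \<le> (SUP (n, m) \<in> {(n, m). n0 \<le> n \<and> n < m}. SUP \<alpha>\<in>K. SUP j\<in>UNIV - {0::int}.
                ennreal (?s n m \<alpha> j))"
        by (rule SUP_upper2[of "(n, p)"]) (use that True in auto)
      also note n0
      finally have "?s n p \<alpha> j \<le> 1" by (simp add: sum_nonneg less_imp_le)
      \<comment> \<open>The closed range \<open>n..p\<close> has one more, nonnegative, term; taking
        \<open>m = p\<close> ensures \<open>n < m\<close>.\<close>
      moreover have "(\<Sum>k\<in>{n..<p}. (norm (char_fun M (X k) (of_int j * \<alpha>)))\<^sup>2) \<le> ?s n p \<alpha> j"
        by (rule sum_mono2) auto
      ultimately show ?thesis by simp
    qed simp
    thus ?thesis by blast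
  qed
  have "\<exists>(N :: nat \<Rightarrow> nat) H B. strict_mono N \<and> (\<forall>m. H m \<ge> 1 \<and> H m \<ge> real m \<and> real (N (Suc m)) \<le> exp (H m)) \<and>
           (\<forall>m k. k < N (Suc m) \<longrightarrow> B k \<le> exp (H m)) \<and>
           summable (\<lambda>m. sqrt (R (N m) * H m)) \<and>
           summable (\<lambda>k. prob {\<omega>\<in>space M. B k < \<bar>X k \<omega>\<bar>})"
    using assms(3)
  proof (elim disjE exE conjE)
    assume "polynomial_case M X" and c: "\<forall>n\<ge>1. c n = 1 + sqrt (ln (real n))"
    then obtain \<beta> d where m: "\<beta> > 0" "d > 0" "moment_bigo M X \<beta> (\<lambda>k. real k powr d)"
      by (auto simp: polynomial_case_def)
    define B where "B k = (real k powr d * real k ^ 2) powr (1 / \<beta>)" for k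
    have "summable (\<lambda>k. prob {\<omega>\<in>space M. (real k powr d * real k ^ 2) powr (1 / \<beta>) < \<bar>X k \<omega>\<bar>})"
      by (rule moment_bigo_imp_summable_tail[OF m(3,1) _ rv]) simp
    thus ?thesis
      using polynomial_blocks[OF m(2,1) c[rule_format] Rmono R0 sR]
      by (simp only: B_def[symmetric]) blast
  next
    fix \<gamma> assume "subexponential_case M X \<gamma>" and c: "\<forall>n\<ge>1. c n = real n powr (- \<gamma> / 2)"
    then obtain \<beta> where m: "0 < \<gamma>" "\<gamma> < 1" "\<beta> > 0" "moment_bigo M X \<beta> (\<lambda>k. 2 powr (real k powr \<gamma>))"
      by (auto simp: subexponential_case_def)
    define B where "B k = (2 powr (real k powr \<gamma>) * real k ^ 2) powr (1 / \<beta>)" for k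
    have "summable (\<lambda>k. prob {\<omega>\<in>space M. (2 powr (real k powr \<gamma>) * real k ^ 2) powr (1 / \<beta>) < \<bar>X k \<omega>\<bar>})"
      by (rule moment_bigo_imp_summable_tail[OF m(4,3) _ rv]) simp
    thus ?thesis
      using subexponential_blocks[OF m(1-3) c[rule_format] Rmono R0 sR]
      by (simp only: B_def[symmetric]) blast
  qed
  then obtain N :: "nat \<Rightarrow> nat" and H B where *:
      "strict_mono N" "\<And>m. H m \<ge> 1" "\<And>m. H m \<ge> real m" "\<And>m. real (N (Suc m)) \<le> exp (H m)"
      "\<And>m k. k < N (Suc m) \<Longrightarrow> B k \<le> exp (H m)" "summable (\<lambda>m. sqrt (R (N m) * H m))"
      "summable (\<lambda>k. prob {\<omega>\<in>space M. B k < \<bar>X k \<omega>\<bar>})"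
    by blast
  have "AE \<omega> in M. \<forall>f\<in>B_space. integral {0..1} f = 0 \<longrightarrow> (\<forall>K. compact K \<and> 0 \<notin> K \<longrightarrow>
           uniformly_Cauchy_on K (\<lambda>n \<alpha>. \<Sum>k<n. a k * f (\<alpha> * X k \<omega>)))"
    by (rule AE_uniformly_Cauchy_random_series[OF indep *(1-5,7) Rsum *(6) char])
  \<comment> \<open>The failure set involves uncountably many \<open>f\<close> and \<open>K\<close>,
    so it is enclosed in a measurable null set instead of being shown measurable itself.\<close>
  then obtain \<Omega> where \<Omega>: "\<Omega> \<in> null_sets M"
      "{\<omega>\<in>space M. \<not> (\<forall>f\<in>B_space. integral {0..1} f = 0 \<longrightarrow> (\<forall>K. compact K \<and> 0 \<notin> K \<longrightarrow>
           uniformly_Cauchy_on K (\<lambda>n \<alpha>. \<Sum>k<n. a k * f (\<alpha> * X k \<omega>))))} \<subseteq> \<Omega>"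
    by (auto simp: eventually_ae_filter)
  show ?thesis
  proof (intro bexI[of _ "space M - \<Omega>"] conjI ballI impI allI)
    show "space M - \<Omega> \<in> sets M" using \<Omega>(1) by auto
    show "prob (space M - \<Omega>) = 1"
      using \<Omega>(1) by (subst prob_compl) (auto simp: measure_eq_0_null_sets)
    fix \<omega> f assume \<omega>: "\<omega> \<in> space M - \<Omega>" and f: "f \<in> B_space" "integral {0..1} f = 0"
    have C: "uniformly_Cauchy_on K (\<lambda>n \<alpha>. \<Sum>k<n. a k * f (\<alpha> * X k \<omega>))" if "compact K" "0 \<notin> K" for K
      using \<Omega>(2) \<omega> f that by blast
    note props = random_series_properties[where a = a and X = X and \<omega> = \<omega>, OF f(1) C]
    show "summable (\<lambda>k. a k * f (\<alpha> * X k \<omega>))" if "\<alpha> \<noteq> 0" for \<alpha>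
      using props(1) that by blast
    show "continuous_on (UNIV - {0}) (\<lambda>\<alpha>. random_series a f X \<alpha> \<omega>)"
      by (rule props(2))
    show "uniform_limit K (\<lambda>n \<alpha>. \<Sum>k<n. a k * f (\<alpha> * X k \<omega>))
        (\<lambda>\<alpha>. random_series a f X \<alpha> \<omega>) sequentially" if "compact K \<and> 0 \<notin> K" for K
      using props(3) that by blast
  qed
qed

end
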